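(* There exists a connected graph of bounded degree that is transient and Gromov-hyperbolic and contains no transient subtree.
   Context: A graph is transient if simple random walk on it is transient. A subtree is a subgraph that is a tree; it is transient if simple random walk on that tree is transient. *)

theory Defs
  imports "HOL-Probability.Probability" "Graph_Theory.Digraph_Component"
begin

section \<open>Graphs\<close>

text \<open>
  A simple, possibly infinite, undirected graph is a \<^locale>\<open>pair_bidirected_digraph\<close>: a
  loop-free digraph without parallel arcs whose arc relation is symmetric, so that an undirected
  edge \<open>uv\<close> is the pair of arcs \<open>(u,v)\<close>, \<open>(v,u)\<close>.  In particular the degree of a vertex is its
  out-degree.  Connectedness includes non-emptiness.
\<close>

definition bounded_degree :: "'a pair_pre_digraph \<Rightarrow> bool" where
  "bounded_degree G \<longleftrightarrow>
     (\<exists>d. \<forall>v\<in>pverts G. finite (out_arcs (with_proj G) v) \<and> out_degree (with_proj G) v \<le> d)"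

text \<open>
  The predicate \<^const>\<open>tree\<close> of the library is not suitable for undirected graphs, since it regards
  the walk \<open>u v u\<close> along a single edge as a cycle.  A cycle of an undirected graph has length at
  least three.
\<close>

definition undirected_tree :: "'a pair_pre_digraph \<Rightarrow> bool" where
  "undirected_tree T \<longleftrightarrow> pair_bidirected_digraph T \<and> Digraph_Component.connected (with_proj T) \<and>
     \<not> (\<exists>p. pre_digraph.cycle (with_proj T) p \<and> length p \<ge> 3)"

definition subtree :: "'a pair_pre_digraph \<Rightarrow> 'a pair_pre_digraph \<Rightarrow> bool" where
  "subtree T G \<longleftrightarrow> subgraph (with_proj T) (with_proj G) \<and> undirected_tree T"


section \<open>Gromov hyperbolicity\<close>

text \<open>Only meaningful if \<open>u\<close> and \<open>v\<close> are joined by a walk.\<close>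

definition graph_dist :: "'a pair_pre_digraph \<Rightarrow> 'a \<Rightarrow> 'a \<Rightarrow> nat" where
  "graph_dist G u v = (LEAST n. \<exists>p. pre_digraph.awalk (with_proj G) u p v \<and> length p = n)"

definition gromov_product :: "'a pair_pre_digraph \<Rightarrow> 'a \<Rightarrow> 'a \<Rightarrow> 'a \<Rightarrow> real" where
  "gromov_product G w x y =
     (real (graph_dist G x w) + real (graph_dist G y w) - real (graph_dist G x y)) / 2"

definition gromov_hyperbolic :: "'a pair_pre_digraph \<Rightarrow> bool" where
  "gromov_hyperbolic G \<longleftrightarrow>
     (\<exists>\<delta>\<ge>0. \<forall>w\<in>pverts G. \<forall>x\<in>pverts G. \<forall>y\<in>pverts G. \<forall>z\<in>pverts G.
        gromov_product G w x z \<ge> min (gromov_product G w x y) (gromov_product G w y z) - \<delta>)"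


section \<open>Simple random walk\<close>

text \<open>
  The walk moves to a uniformly chosen neighbour.  At an isolated vertex it stays put, so that the
  one-vertex graph is recurrent.  The definition is meant for locally finite graphs only.
\<close>

definition srw_step :: "'a pair_pre_digraph \<Rightarrow> 'a \<Rightarrow> 'a pmf" where
  "srw_step G v =
     (if parcs G `` {v} = {} then return_pmf v else pmf_of_set (parcs G `` {v}))"

definition srw_kernel :: "'a pair_pre_digraph \<Rightarrow> 'a \<Rightarrow> nat \<Rightarrow> (nat \<Rightarrow> 'a) \<Rightarrow> 'a measure" where
  "srw_kernel G x n \<omega> =
     (case n of 0 \<Rightarrow> measure_pmf (return_pmf x) | Suc k \<Rightarrow> measure_pmf (srw_step G (\<omega> k)))"

text \<open>
  The law, on the space of trajectories \<^typ>\<open>nat \<Rightarrow> 'a\<close>, of simple random walk started at \<open>x\<close>: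
  the measure that the Ionescu-Tulcea theorem yields for the kernels above.  It is characterised
  by lemma \<open>srw_cylinder\<close> below.
\<close>

definition srw :: "'a pair_pre_digraph \<Rightarrow> 'a \<Rightarrow> (nat \<Rightarrow> 'a) measure" where
  "srw G x = projective_family.lim UNIV
     (Ionescu_Tulcea.CI (srw_kernel G x) (\<lambda>_. count_space UNIV)) (\<lambda>_. count_space UNIV)"

definition transient :: "'a pair_pre_digraph \<Rightarrow> bool" where
  "transient G \<longleftrightarrow> (\<forall>x\<in>pverts G. measure (srw G x) {\<omega>. \<exists>n\<ge>1. \<omega> n = x} < 1)"

lemma Ionescu_Tulcea_srw:
  fixes G :: "'a pair_pre_digraph"
  shows "Ionescu_Tulcea (srw_kernel G x) (\<lambda>_. count_space UNIV)"
proof (rule Ionescu_Tulcea.intro)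
  fix i :: nat
  show "srw_kernel G x i \<in> measurable (PiM {0..<i} (\<lambda>_. count_space UNIV)) (subprob_algebra (count_space UNIV))"
  proof (cases i)
    case 0
    then show ?thesis
      by (auto simp: srw_kernel_def[abs_def] space_subprob_algebra
          intro!: measurable_const prob_space_imp_subprob_space prob_space_measure_pmf)
  next
    case (Suc k)
    have "(\<lambda>v. measure_pmf (srw_step G v)) \<in> measurable (count_space UNIV) (subprob_algebra (count_space UNIV))"
      by (auto simp: space_subprob_algebra intro!: prob_space_imp_subprob_space prob_space_measure_pmf)
    moreover have "(\<lambda>\<omega>. \<omega> k) \<in> measurable (PiM {0..<i} (\<lambda>_. count_space UNIV)) (count_space UNIV)"
      using Suc by (intro measurable_component_singleton) auto
    ultimately have "(\<lambda>\<omega>. measure_pmf (srw_step G (\<omega> k))) \<in>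
        measurable (PiM {0..<i} (\<lambda>_. count_space UNIV)) (subprob_algebra (count_space UNIV))"
      by (rule measurable_compose[rotated])
    then show ?thesis by (simp add: srw_kernel_def[abs_def] Suc)
  qed
next
  fix i :: nat and \<omega> :: "nat \<Rightarrow> 'a"
  assume "\<omega> \<in> space (PiM {0..<i} (\<lambda>_. count_space UNIV))"
  show "prob_space (srw_kernel G x i \<omega>)"
    by (cases i) (auto simp: srw_kernel_def prob_space_measure_pmf)
qed

lemma sets_srw: "sets (srw G x) = sets (PiM UNIV (\<lambda>_. count_space UNIV))"
proof -
  interpret Ionescu_Tulcea "srw_kernel G x" "\<lambda>_. count_space UNIV" by (rule Ionescu_Tulcea_srw)
  show ?thesis by (simp add: srw_def)
qed

lemma space_srw [simp]: "space (srw G x) = UNIV"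
  using sets_eq_imp_space_eq[OF sets_srw, of G x] by (simp add: space_PiM PiE_UNIV_domain)

lemma prob_space_srw: "prob_space (srw G x)"
proof
  interpret Ionescu_Tulcea "srw_kernel G x" "\<lambda>_. count_space UNIV" by (rule Ionescu_Tulcea_srw)
  interpret CI: prob_space "CI {}" by (rule PF.prob_space_P) auto
  have "emeasure PF.lim (PF.emb UNIV {} (space (CI {}))) = emeasure (CI {}) (space (CI {}))"
    by (rule lim) (auto simp: CI_def)
  moreover have "PF.emb UNIV {} (space (CI {})) = UNIV"
    by (auto simp: CI_def prod_emb_def space_PiM)
  ultimately show "emeasure (srw G x) (space (srw G x)) = 1"
    by (simp add: srw_def[symmetric] CI.emeasure_space_1)
qed

lemma sets_srw_return:
  fixes G :: "'a pair_pre_digraph"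
  shows "{\<omega>. \<exists>n\<ge>1. \<omega> n = y} \<in> sets (srw G x)"
proof -
  have "(\<lambda>\<omega>. \<omega> n) -` {y} \<inter> space (PiM UNIV (\<lambda>_. count_space UNIV))
      \<in> sets (PiM UNIV (\<lambda>_. count_space (UNIV :: 'a set)))" for n :: nat
    by (rule measurable_sets[OF measurable_component_singleton]) auto
  then have "(\<Union>n\<in>{1..}. {\<omega>. \<omega> n = y}) \<in> sets (srw G x)"
    by (intro sets.countable_UN') (auto simp: sets_srw space_PiM PiE_UNIV_domain vimage_def)
  also have "(\<Union>n\<in>{1..}. {\<omega>. \<omega> n = y}) = {\<omega>. \<exists>n\<ge>1. \<omega> n = y}" by auto
  finally show ?thesis .
qed

lemma srw_cylinder:
  "emeasure (srw G x) {\<omega>. \<forall>i\<le>n. \<omega> i = p i} =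
     (if p 0 = x then \<Prod>i<n. ennreal (pmf (srw_step G (p i)) (p (Suc i))) else 0)"
proof -
  interpret Ionescu_Tulcea "srw_kernel G x" "\<lambda>_. count_space UNIV" by (rule Ionescu_Tulcea_srw)
  define A where "A n = {\<omega> \<in> space (PiM {0..<n} (\<lambda>_. count_space UNIV)). \<forall>i<n. \<omega> i = p i}" for n
  have A_eq: "A n = PiE {0..<n} (\<lambda>i. {p i})" for n
    by (auto simp: A_def space_PiM PiE_iff extensional_def)
  have A_sets [measurable]: "A n \<in> sets (PiM {0..<n} (\<lambda>_. count_space UNIV))" for n
    unfolding A_eq by (intro sets_PiM_I_finite) auto
  have step: "emeasure (eP n \<omega>) (A (Suc n)) =
      emeasure (srw_kernel G x n \<omega>) {p n} * indicator (A n) \<omega>"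
    if "\<omega> \<in> space (PiM {0..<n} (\<lambda>_. count_space UNIV))" for n \<omega>
  proof -
    have "fun_upd \<omega> n -` A (Suc n) = (if \<omega> \<in> A n then {p n} else {})"
      using that by (auto simp: A_def space_PiM PiE_iff extensional_def less_Suc_eq split: if_splits)
    then show ?thesis
      using that by (simp add: emeasure_eP split: split_indicator)
  qed
  have C_A: "emeasure (C 0 (Suc n) (\<lambda>_. undefined)) (A (Suc n)) =
      (if p 0 = x then \<Prod>i<n. ennreal (pmf (srw_step G (p i)) (p (Suc i))) else 0)" for n
  proof -
    have rec: "emeasure (C 0 (Suc n) (\<lambda>_. undefined)) (A (Suc n)) =
      (\<integral>\<^sup>+\<omega>. emeasure (srw_kernel G x n \<omega>) {p n} * indicator (A n) \<omega> \<partial>C 0 n (\<lambda>_. undefined))" for n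
    proof -
      let ?C = "C 0 n (\<lambda>_. undefined)"
      have ne: "space ?C \<noteq> {}"
        by (rule prob_space.not_empty[OF prob_space_C]) simp
      have "sets ?C = sets (PiM {0..<n} (\<lambda>_. count_space UNIV))"
        using sets_C[of "\<lambda>_. undefined" 0 n] by simp
      then have "eP n \<in> measurable ?C (subprob_algebra (PiM {0..<Suc n} (\<lambda>_. count_space UNIV)))"
        using measurable_eP by (simp cong: measurable_cong_sets)
      then have "emeasure (?C \<bind> eP n) (A (Suc n)) = (\<integral>\<^sup>+\<omega>. emeasure (eP n \<omega>) (A (Suc n)) \<partial>?C)"
        by (rule emeasure_bind[OF ne _ A_sets])
      also have "\<dots> = (\<integral>\<^sup>+\<omega>. emeasure (srw_kernel G x n \<omega>) {p n} * indicator (A n) \<omega> \<partial>?C)"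
        using space_C[of "\<lambda>_. undefined" 0 n] by (intro nn_integral_cong step) simp
      finally show ?thesis by simp
    qed
    show ?thesis
    proof (induction n)
      case 0
      show ?case
        unfolding rec
        using A_sets[of 0]
        by (simp add: srw_kernel_def nn_integral_cmult_indicator del: nn_integral_indicator_singleton)
          (auto simp: A_def emeasure_pmf_single indicator_def)
    next
      case (Suc n)
      have "emeasure (C 0 (Suc (Suc n)) (\<lambda>_. undefined)) (A (Suc (Suc n))) =
        (\<integral>\<^sup>+\<omega>. ennreal (pmf (srw_step G (p n)) (p (Suc n))) * indicator (A (Suc n)) \<omega> \<partial>C 0 (Suc n) (\<lambda>_. undefined))"
        unfolding rec[of "Suc n"]
        by (intro nn_integral_cong) (auto simp: srw_kernel_def emeasure_pmf_single A_def split: split_indicator)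
      also have "\<dots> = ennreal (pmf (srw_step G (p n)) (p (Suc n))) * emeasure (C 0 (Suc n) (\<lambda>_. undefined)) (A (Suc n))"
        by (rule nn_integral_cmult_indicator) (use A_sets[of "Suc n"] sets_C[of "\<lambda>_. undefined" 0 "Suc n"] in \<open>simp del: C.simps\<close>)
      finally show ?case unfolding Suc.IH by (simp add: mult.commute)
    qed
  qed
  have "{\<omega>. \<forall>i\<le>n. \<omega> i = p i} = PF.emb UNIV {0..<Suc n} (A (Suc n))"
    by (auto simp: A_def prod_emb_def space_PiM less_Suc_eq_le)
  then have "emeasure (srw G x) {\<omega>. \<forall>i\<le>n. \<omega> i = p i} = emeasure (CI {0..<Suc n}) (A (Suc n))"
    by (simp only: srw_def lim[OF finite_atLeastLessThan A_sets])
  also have "\<dots> = emeasure (C 0 (Suc n) (\<lambda>_. undefined)) (PF.emb {0..<Suc n} {0..<Suc n} (A (Suc n)))"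
    by (rule emeasure_CI) auto
  also have "PF.emb {0..<Suc n} {0..<Suc n} (A (Suc n)) = A (Suc n)"
    by (rule prod_emb_id) (auto simp: A_eq PiE_def)
  finally show ?thesis unfolding C_A .
qed

end

theory Submission
  imports Defs "HOL-Library.Sublist"
begin

text \<open>
  The graph is a binary tree of finite blocks.  A block of generation \<open>n\<close> has a single entry and a
  single exit, and these are \<open>2\<^sup>n\<close> apart.  The block is a hyperbolic cone over a three-dimensional
  cube: its level \<open>k\<close> is the grid \<open>{0..<2\<^sup>k}\<^sup>3\<close>, consecutive levels are joined by halving the
  coordinates, the entry is level \<open>0\<close>, and the exit is a corner of the bottom level.

  Since two horizontal steps project to at most one, horizontal walks shrink exponentially on the
  way up.  So distances are determined, up to an additive constant, by the highest level at which the
  ancestors of two vertices are still equal or adjacent, which gives hyperbolicity.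

  The resistance of every block is bounded: a current from the entry spreads over the bottom grid and
  is collected at the corner, which costs a bounded amount because the grid has dimension three.
  There are \<open>2\<^sup>n\<close> blocks of generation \<open>n\<close>, so the total resistance is finite and the graph is
  transient.  A subtree, however, crosses a block of generation \<open>n\<close> only along a path of at least
  \<open>2\<^sup>n\<close> edges each of which is a cut edge.  So each generation \<open>n\<close> provides \<open>2\<^sup>n\<close> disjoint cutsets
  with at most \<open>2\<^sup>n\<close> edges, and the subtree is recurrent by the Nash-Williams criterion.
\<close>

section \<open>Return probabilities of simple random walk\<close>

text \<open>The law of the first \<open>n\<close> positions after the start, with the start left
  out. Unlike the law on trajectories it lends itself directly to first-step analysis.\<close>

primrec walk_pmf :: "'a pair_pre_digraph \<Rightarrow> nat \<Rightarrow> 'a \<Rightarrow> 'a list pmf" where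
  "walk_pmf G 0 v = return_pmf []"
| "walk_pmf G (Suc n) v = bind_pmf (srw_step G v) (\<lambda>y. map_pmf (Cons y) (walk_pmf G n y))"

lemma pmf_walk_pmf_Cons:
  "pmf (walk_pmf G (Suc n) v) (y # p) = pmf (srw_step G v) y * pmf (walk_pmf G n y) p"
proof -
  have "pmf (walk_pmf G (Suc n) v) (y # p) =
     (\<integral>z. pmf (map_pmf (Cons z) (walk_pmf G n z)) (y # p) \<partial>measure_pmf (srw_step G v))"
    by (simp add: pmf_bind)
  also have "(\<lambda>z. pmf (map_pmf (Cons z) (walk_pmf G n z)) (y # p))
      = (\<lambda>z. indicator {y} z * pmf (walk_pmf G n y) p)"
  proof
    fix z
    show "pmf (map_pmf (Cons z) (walk_pmf G n z)) (y # p) = indicator {y} z * pmf (walk_pmf G n y) p"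
    proof (cases "z = y")
      case True
      then show ?thesis by (simp add: pmf_map_inj')
    next
      case False
      then have "y # p \<notin> set_pmf (map_pmf (Cons z) (walk_pmf G n z))" by auto
      then have "pmf (map_pmf (Cons z) (walk_pmf G n z)) (y # p) = 0" by (simp add: pmf_eq_0_set_pmf)
      then show ?thesis using False by simp
    qed
  qed
  also have "(\<integral>z. indicator {y} z * pmf (walk_pmf G n y) p \<partial>measure_pmf (srw_step G v))
      = pmf (srw_step G v) y * pmf (walk_pmf G n y) p"
    by (simp add: measure_pmf_single)
  finally show ?thesis .
qed

lemma length_walk_pmf: "p \<in> set_pmf (walk_pmf G n v) \<Longrightarrow> length p = n"
  by (induction n arbitrary: v p) auto

lemma pmf_walk_pmf:
  assumes "length p = n"
  shows "ennreal (pmf (walk_pmf G n v) p) =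
     (\<Prod>i<n. ennreal (pmf (srw_step G ((v # p) ! i)) ((v # p) ! Suc i)))"
  using assms
proof (induction n arbitrary: v p)
  case 0
  then show ?case by simp
next
  case (Suc n)
  then obtain y q where p: "p = y # q" and q: "length q = n" by (cases p) auto
  show ?case
    unfolding p pmf_walk_pmf_Cons prod.lessThan_Suc_shift
    by (simp add: ennreal_mult'' Suc.IH[OF q])
qed

lemma measurable_srw_component:
  fixes G :: "'a pair_pre_digraph"
  shows "(\<lambda>\<omega>. \<omega> i) \<in> measurable (srw G v) (count_space UNIV)"
  using measurable_component_singleton[of i UNIV "\<lambda>_. count_space (UNIV :: 'a set)"]
  by (simp add: measurable_cong_sets[OF sets_srw refl])

lemma sets_srw_component:
  fixes G :: "'a pair_pre_digraph"
  shows "{\<omega>. \<omega> i = y} \<in> sets (srw G v)"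
proof -
  have "(\<lambda>\<omega>. \<omega> i) -` {y} \<inter> space (srw G v) \<in> sets (srw G v)"
    by (rule measurable_sets[OF measurable_srw_component]) simp
  moreover have "(\<lambda>\<omega>. \<omega> i) -` {y} \<inter> space (srw G v) = {\<omega>. \<omega> i = y}" by auto
  ultimately show "{\<omega>. \<omega> i = y} \<in> sets (srw G v)" by (simp only:)
qed

lemma measurable_trajectory:
  fixes G :: "'a::countable pair_pre_digraph"
  shows "(\<lambda>\<omega>. map \<omega> [1..<Suc n]) \<in> measurable (srw G v) (count_space UNIV)"
proof -
  \<comment> \<open>There are only countably many lists, so measurability can be checked on single
    lists.\<close>
  have "(\<lambda>\<omega>. map \<omega> [1..<Suc n]) -` {p} \<inter> space (srw G v) \<in> sets (srw G v)" for p :: "'a list"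
  proof -
    have nth: "map \<omega> [1..<Suc n] = p \<longleftrightarrow> length p = n \<and> (\<forall>i<n. \<omega> (Suc i) = p ! i)" for \<omega>
      unfolding list_eq_iff_nth_eq by (auto simp del: upt_Suc)
    have "(\<lambda>\<omega>. map \<omega> [1..<Suc n]) -` {p} \<inter> space (srw G v) =
        {\<omega>. length p = n \<and> (\<forall>i<n. \<omega> (Suc i) = p ! i)}"
      unfolding vimage_def singleton_iff nth space_srw by simp
    also have "\<dots> = (if length p = n then {\<omega> \<in> space (srw G v). \<forall>i\<in>{..<n}. \<omega> (Suc i) = p ! i} else {})"
      by auto
    also have "\<dots> \<in> sets (srw G v)"
    proof -
      have "{\<omega> \<in> space (srw G v). \<forall>i\<in>{..<n}. \<omega> (Suc i) = p ! i} \<in> sets (srw G v)"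
        by (rule sets.sets_Collect_finite_All) (simp_all add: sets_srw_component)
      then show ?thesis by (cases "length p = n") (simp_all only: if_True if_False simp_thms sets.empty_sets)
    qed
    finally show "(\<lambda>\<omega>. map \<omega> [1..<Suc n]) -` {p} \<inter> space (srw G v) \<in> sets (srw G v)" .
  qed
  then show ?thesis
    by (simp only: measurable_count_space_eq2_countable) blast
qed

text \<open>Both sides live on a countable type, so singletons suffice. Up to the null event
  \<open>\<omega> 0 \<noteq> v\<close>, the preimage of \<open>p\<close> is the cylinder over
  \<open>v # p\<close>.\<close>

lemma distr_srw_walk_pmf:
  fixes G :: "'a::countable pair_pre_digraph"
  shows "distr (srw G v) (count_space UNIV) (\<lambda>\<omega>. map \<omega> [1..<Suc n]) = measure_pmf (walk_pmf G n v)"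
proof (rule measure_eqI_countable[where A = UNIV])
  note m = measurable_trajectory[of n G v]
  fix p :: "'a list"
  have AE0: "AE \<omega> in srw G v. \<omega> 0 = v"
  proof (rule prob_space.AE_I_eq_1[OF prob_space_srw])
    have *: "{\<omega> \<in> space (srw G v). \<omega> 0 = v} = {\<omega>. \<forall>i\<le>0. \<omega> i = (\<lambda>_. v) i}" by auto
    show "emeasure (srw G v) {\<omega> \<in> space (srw G v). \<omega> 0 = v} = 1"
      unfolding * srw_cylinder by simp
    show "{\<omega> \<in> space (srw G v). \<omega> 0 = v} \<in> sets (srw G v)"
      unfolding * by (simp only: atMost_0 le_zero_eq simp_thms sets_srw_component)
  qed
  show "emeasure (distr (srw G v) (count_space UNIV) (\<lambda>\<omega>. map \<omega> [1..<Suc n])) {p} =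
        emeasure (walk_pmf G n v) {p}"
  proof (cases "length p = n")
    case False
    then have "(\<lambda>\<omega>. map \<omega> [1..<Suc n]) -` {p} \<inter> space (srw G v) = {}" by auto
    moreover have "pmf (walk_pmf G n v) p = 0"
      using False length_walk_pmf[of p G n v] by (auto simp: pmf_eq_0_set_pmf)
    ultimately show ?thesis
      unfolding emeasure_pmf_single emeasure_distr[OF m UNIV_I[of "{p}", folded Pow_UNIV, folded sets_count_space]] by simp
  next
    case True
    have "emeasure (distr (srw G v) (count_space UNIV) (\<lambda>\<omega>. map \<omega> [1..<Suc n])) {p} =
       emeasure (srw G v) ((\<lambda>\<omega>. map \<omega> [1..<Suc n]) -` {p} \<inter> space (srw G v))"
      by (rule emeasure_distr[OF m]) simp
    also have "\<dots> = emeasure (srw G v) {\<omega>. \<forall>i\<le>n. \<omega> i = (v # p) ! i}"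
    proof (rule emeasure_eq_AE)
      show "AE \<omega> in srw G v. (\<omega> \<in> (\<lambda>\<omega>. map \<omega> [1..<Suc n]) -` {p} \<inter> space (srw G v))
          \<longleftrightarrow> (\<omega> \<in> {\<omega>. \<forall>i\<le>n. \<omega> i = (v # p) ! i})"
        using AE0
      proof eventually_elim
        case (elim \<omega>)
        have "map \<omega> [1..<Suc n] = p \<longleftrightarrow> (\<forall>i<n. \<omega> (Suc i) = p ! i)"
          using True by (auto simp: list_eq_iff_nth_eq simp del: upt_Suc)
        also have "\<dots> \<longleftrightarrow> (\<forall>i\<le>n. \<omega> i = (v # p) ! i)"
          using elim by (auto simp: nth_Cons split: nat.split)
        finally show ?case by (simp del: upt_Suc)
      qed
      show "(\<lambda>\<omega>. map \<omega> [1..<Suc n]) -` {p} \<inter> space (srw G v) \<in> sets (srw G v)"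
        using measurable_sets[OF m, of "{p}"] by simp
      have "{\<omega>. \<forall>i\<le>n. \<omega> i = (v # p) ! i} = (\<Inter>i\<in>{..n}. {\<omega>. \<omega> i = (v # p) ! i})" by auto
      also have "\<dots> \<in> sets (srw G v)"
        by (intro sets.finite_INT sets_srw_component) auto
      finally show "{\<omega>. \<forall>i\<le>n. \<omega> i = (v # p) ! i} \<in> sets (srw G v)" .
    qed
    also have "\<dots> = ennreal (pmf (walk_pmf G n v) p)"
      unfolding srw_cylinder pmf_walk_pmf[OF True] by simp
    finally show ?thesis by (simp add: emeasure_pmf_single)
  qed
qed auto

text \<open>The probability that the walk from \<open>v\<close> visits \<open>x\<close> at a time \<open>\<le> n\<close>, time \<open>0\<close> included.\<close>

definition hit :: "'a pair_pre_digraph \<Rightarrow> 'a \<Rightarrow> nat \<Rightarrow> 'a \<Rightarrow> real" where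
  "hit G x n v = (if v = x then 1 else measure_pmf.prob (walk_pmf G n v) {p. x \<in> set p})"

lemma hit_bounds: "0 \<le> hit G x n v" "hit G x n v \<le> 1" "\<bar>hit G x n v\<bar> \<le> 1"
  by (auto simp: hit_def)

text \<open>After a first step to \<open>y\<close> the list meets \<open>x\<close> iff
  \<open>y = x\<close> or its tail does; the value 1 of \<open>hit\<close> at \<open>x\<close>
  merges the two cases.\<close>

lemma prob_walk_pmf_Suc:
  "measure_pmf.prob (walk_pmf G (Suc n) v) {p. x \<in> set p}
     = measure_pmf.expectation (srw_step G v) (hit G x n)"
proof -
  have "ennreal (measure_pmf.prob (walk_pmf G (Suc n) v) {p. x \<in> set p}) =
     (\<integral>\<^sup>+y. ennreal (hit G x n y) \<partial>srw_step G v)"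
    unfolding measure_pmf.emeasure_eq_measure[symmetric] walk_pmf.simps emeasure_bind_pmf
    by (intro nn_integral_cong)
      (auto simp: hit_def vimage_def measure_pmf.emeasure_eq_measure)
  also have "\<dots> = ennreal (measure_pmf.expectation (srw_step G v) (hit G x n))"
    by (intro nn_integral_eq_integral measure_pmf.integrable_const_bound[where B = 1])
      (auto simp: hit_bounds)
  finally show ?thesis
    by (subst (asm) ennreal_inj) (auto intro!: integral_nonneg_AE simp: hit_bounds)
qed

lemma return_prob_tendsto:
  fixes G :: "'a::countable pair_pre_digraph"
  shows "(\<lambda>n. measure_pmf.expectation (srw_step G x) (hit G x n))
     \<longlonglongrightarrow> measure (srw G x) {\<omega>. \<exists>n\<ge>1. \<omega> n = x}"
proof -
  interpret prob_space "srw G x" by (rule prob_space_srw)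
  \<comment> \<open>Returns by time \<open>n + 1\<close>: one step is spent on leaving
    \<open>x\<close>, and \<open>hit\<close> counts time 0 of the walk that remains.\<close>
  define A where "A n = {\<omega>. \<exists>i\<in>{1..<Suc (Suc n)}. \<omega> i = x}" for n
  have A_sets: "A n \<in> sets (srw G x)" for n
  proof -
    have "A n = (\<Union>i\<in>{1..<Suc (Suc n)}. {\<omega>. \<omega> i = x})" by (auto simp: A_def)
    also have "\<dots> \<in> sets (srw G x)" by (intro sets.finite_UN sets_srw_component) auto
    finally show ?thesis .
  qed
  have "prob (A n) = measure_pmf.expectation (srw_step G x) (hit G x n)" for n
  proof -
    have A: "A n = (\<lambda>\<omega>. map \<omega> [1..<Suc (Suc n)]) -` {p. x \<in> set p} \<inter> space (srw G x)"
      by (auto simp: A_def simp del: upt_Suc)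
    have "measure (distr (srw G x) (count_space UNIV) (\<lambda>\<omega>. map \<omega> [1..<Suc (Suc n)])) {p. x \<in> set p} = prob (A n)"
      unfolding A by (rule measure_distr[OF measurable_trajectory]) simp
    then show ?thesis
      unfolding distr_srw_walk_pmf prob_walk_pmf_Suc by simp
  qed
  moreover have "(\<lambda>n. prob (A n)) \<longlonglongrightarrow> prob (\<Union>n::nat. A n)"
  proof (rule finite_Lim_measure_incseq)
    show "range A \<subseteq> events" using A_sets by blast
    show "incseq A" unfolding incseq_def A_def by fastforce
  qed
  moreover have "(\<Union>n::nat. A n) = {\<omega>. \<exists>n\<ge>1. \<omega> n = x}"
  proof (intro equalityI subsetI)
    fix \<omega> :: "nat \<Rightarrow> 'a" assume "\<omega> \<in> {\<omega>. \<exists>n\<ge>1. \<omega> n = x}"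
    then obtain n where "n \<ge> 1" "\<omega> n = x" by auto
    then have "\<omega> \<in> A n" by (auto simp: A_def intro!: bexI[of _ n])
    then show "\<omega> \<in> (\<Union>n::nat. A n)" by blast
  qed (auto simp: A_def)
  ultimately show ?thesis by simp
qed

section \<open>Dirichlet energy and recurrence\<close>

text \<open>Every edge counts twice, once for each direction.\<close>

definition energy :: "'a pair_pre_digraph \<Rightarrow> ('a \<Rightarrow> real) \<Rightarrow> real" where
  "energy G f = (\<Sum>a\<in>{a \<in> parcs G. f (fst a) \<noteq> f (snd a)}. (f (fst a) - f (snd a))\<^sup>2)"

locale locally_finite_graph =
  fixes G :: "'a::countable pair_pre_digraph"
  assumes sym: "(u, v) \<in> parcs G \<Longrightarrow> (v, u) \<in> parcs G"
    and fin: "finite (parcs G `` {v})"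
begin

definition arcs_at :: "'a set \<Rightarrow> ('a \<times> 'a) set" where
  "arcs_at S = {a \<in> parcs G. fst a \<in> S \<or> snd a \<in> S}"

lemma finite_arcs_at:
  assumes "finite S"
  shows "finite (arcs_at S)"
proof -
  let ?A = "SIGMA u:S. parcs G `` {u}"
  have "arcs_at S \<subseteq> ?A \<union> prod.swap ` ?A"
    using sym by (force simp: arcs_at_def)
  moreover have "finite (?A \<union> prod.swap ` ?A)" using assms fin by auto
  ultimately show ?thesis by (rule finite_subset)
qed

lemma swap_arcs_at: "prod.swap ` arcs_at S = arcs_at S"
proof -
  have "prod.swap ` arcs_at S \<subseteq> arcs_at S" using sym by (auto simp: arcs_at_def)
  moreover from image_mono[OF this, of prod.swap] have "arcs_at S \<subseteq> prod.swap ` arcs_at S"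
    by (simp add: image_image)
  ultimately show ?thesis by auto
qed

text \<open>An infinite sum would default to 0, which is why \<open>energy\<close> keeps only the
  arcs along which \<open>f\<close> changes; the arcs added here contribute 0.\<close>

lemma energy_eq_sum:
  assumes "finite A" "A \<subseteq> parcs G" "\<And>a. a \<in> parcs G \<Longrightarrow> f (fst a) \<noteq> f (snd a) \<Longrightarrow> a \<in> A"
  shows "energy G f = (\<Sum>a\<in>A. (f (fst a) - f (snd a))\<^sup>2)"
  unfolding energy_def using assms by (intro sum.mono_neutral_left) auto

lemma energy_eq_sum_arcs_at:
  assumes "finite S" "\<And>v. f v \<noteq> 0 \<Longrightarrow> v \<in> S"
  shows "energy G f = (\<Sum>a\<in>arcs_at S. (f (fst a) - f (snd a))\<^sup>2)"
proof (rule energy_eq_sum)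
  show "a \<in> arcs_at S" if "a \<in> parcs G" "f (fst a) \<noteq> f (snd a)" for a
    using assms(2)[of "fst a"] assms(2)[of "snd a"] that
    by (cases "f (fst a) = 0") (auto simp: arcs_at_def)
qed (use assms finite_arcs_at in \<open>auto simp: arcs_at_def\<close>)

lemma sum_le_energy:
  assumes "finite S" "\<And>v. f v \<noteq> 0 \<Longrightarrow> v \<in> S" "finite A" "A \<subseteq> parcs G"
  shows "(\<Sum>a\<in>A. (f (fst a) - f (snd a))\<^sup>2) \<le> energy G f"
proof -
  have "energy G f = (\<Sum>a\<in>arcs_at S. (f (fst a) - f (snd a))\<^sup>2)"
    using assms(1,2) by (rule energy_eq_sum_arcs_at)
  also have "\<dots> = (\<Sum>a\<in>arcs_at S \<union> A. (f (fst a) - f (snd a))\<^sup>2)"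
  proof (rule sum.mono_neutral_left)
    show "\<forall>i\<in>arcs_at S \<union> A - arcs_at S. (f (fst i) - f (snd i))\<^sup>2 = 0"
    proof
      fix a assume "a \<in> arcs_at S \<union> A - arcs_at S"
      then have "fst a \<notin> S" "snd a \<notin> S" using assms(4) by (auto simp: arcs_at_def)
      then have "f (fst a) = 0" "f (snd a) = 0" using assms(2) by blast+
      then show "(f (fst a) - f (snd a))\<^sup>2 = 0" by simp
    qed
  qed (use assms finite_arcs_at in auto)
  also have "\<dots> \<ge> (\<Sum>a\<in>A. (f (fst a) - f (snd a))\<^sup>2)"
    using assms finite_arcs_at by (intro sum_mono2) auto
  finally show ?thesis .
qed

section \<open>Laplacian and Green's identity\<close>

definition laplacian :: "('a \<Rightarrow> real) \<Rightarrow> 'a \<Rightarrow> real" where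
  "laplacian f v = (\<Sum>y\<in>parcs G `` {v}. f v - f y)"

lemma laplacian_eq:
  "laplacian f v = card (parcs G `` {v}) * (f v - measure_pmf.expectation (srw_step G v) f)"
proof (cases "parcs G `` {v} = {}")
  case True
  then show ?thesis by (simp add: laplacian_def)
next
  case False
  then have "measure_pmf.expectation (srw_step G v) f = sum f (parcs G `` {v}) / card (parcs G `` {v})"
    using fin by (simp add: srw_step_def integral_pmf_of_set)
  then show ?thesis
    using False fin by (simp add: laplacian_def sum_subtractf field_simps)
qed

text \<open>Summation by parts: the terms are split by \<open>f\<close> at the tail and
  \<open>f\<close> at the head of an arc, and reversing the arcs identifies the two halves, whence
  the factor 2. Arcs with tail outside \<open>S\<close> carry no weight.\<close>

lemma green_identity:
  assumes "finite S" "\<And>v. f v \<noteq> 0 \<Longrightarrow> v \<in> S"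
  shows "(\<Sum>a\<in>arcs_at S. (f (fst a) - f (snd a)) * (g (fst a) - g (snd a))) = 2 * (\<Sum>v\<in>S. f v * laplacian g v)"
proof -
  have swap: "(\<Sum>a\<in>arcs_at S. h (prod.swap a)) = (\<Sum>a\<in>arcs_at S. h a)" for h :: "'a \<times> 'a \<Rightarrow> real"
    using sum.reindex[of prod.swap "arcs_at S" h] by (simp add: swap_arcs_at)
  have "(\<Sum>a\<in>arcs_at S. (f (fst a) - f (snd a)) * (g (fst a) - g (snd a)))
      = (\<Sum>a\<in>arcs_at S. f (fst a) * (g (fst a) - g (snd a)))
      + (\<Sum>a\<in>arcs_at S. f (snd a) * (g (snd a) - g (fst a)))"
    unfolding sum.distrib[symmetric] by (intro sum.cong) (auto simp: algebra_simps)
  also have "(\<Sum>a\<in>arcs_at S. f (snd a) * (g (snd a) - g (fst a)))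
      = (\<Sum>a\<in>arcs_at S. f (fst a) * (g (fst a) - g (snd a)))"
    using swap[of "\<lambda>a. f (fst a) * (g (fst a) - g (snd a))"] by simp
  also have "(\<Sum>a\<in>arcs_at S. f (fst a) * (g (fst a) - g (snd a)))
      = (\<Sum>a\<in>(SIGMA u:S. parcs G `` {u}). f (fst a) * (g (fst a) - g (snd a)))"
  proof (rule sum.mono_neutral_right)
    show "finite (arcs_at S)" using finite_arcs_at assms by blast
    show "(SIGMA u:S. parcs G `` {u}) \<subseteq> arcs_at S" by (auto simp: arcs_at_def)
    show "\<forall>a\<in>arcs_at S - (SIGMA u:S. parcs G `` {u}). f (fst a) * (g (fst a) - g (snd a)) = 0"
      using assms(2) by (fastforce simp: arcs_at_def)
  qed
  also have "\<dots> = (\<Sum>v\<in>S. f v * laplacian g v)"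
    unfolding laplacian_def sum_distrib_left
    using assms(1) fin by (subst sum.Sigma) (auto simp: case_prod_beta)
  finally show ?thesis by simp
qed

section \<open>Hitting probabilities as test functions\<close>

lemma hit_self [simp]: "hit G x n x = 1"
  by (simp add: hit_def)

lemma hit_Suc: "v \<noteq> x \<Longrightarrow> hit G x (Suc n) v = measure_pmf.expectation (srw_step G v) (hit G x n)"
  unfolding prob_walk_pmf_Suc[symmetric] by (simp add: hit_def)

lemma integrable_hit: "integrable (measure_pmf (srw_step G v)) (hit G x n)"
  by (intro measure_pmf.integrable_const_bound[where B = 1]) (auto simp: hit_bounds)

lemma hit_mono: "hit G x n v \<le> hit G x (Suc n) v"
proof (induction n arbitrary: v)
  case 0
  show ?case using hit_bounds(1)[of G x "Suc 0" v] by (cases "v = x") (simp_all add: hit_def[of G x 0])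
next
  case (Suc n)
  show ?case
  proof (cases "v = x")
    case False
    then show ?thesis
      unfolding hit_Suc[OF False] by (intro integral_mono integrable_hit Suc)
  qed simp
qed

text \<open>A walk that meets \<open>x\<close> within \<open>n\<close> steps starts at distance at
  most \<open>n\<close>, so each step enlarges the support by at most one layer of
  neighbours.\<close>

lemma finite_support_hit: "finite {v. hit G x n v \<noteq> 0}"
proof (induction n)
  case 0
  have "{v. hit G x 0 v \<noteq> 0} \<subseteq> {x}" by (auto simp: hit_def)
  then show ?case by (rule finite_subset) simp
next
  case (Suc n)
  let ?S = "{v. hit G x n v \<noteq> 0}"
  have "v \<in> insert x (?S \<union> (\<Union>y\<in>?S. parcs G `` {y}))" if "hit G x (Suc n) v \<noteq> 0" for v
  proof (rule ccontr)
    assume v: "v \<notin> insert x (?S \<union> (\<Union>y\<in>?S. parcs G `` {y}))"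
    have "laplacian (hit G x n) v = 0"
      unfolding laplacian_def using v sym by (intro sum.neutral) auto
    then have "hit G x n v = hit G x (Suc n) v \<or> parcs G `` {v} = {}"
      using v fin by (auto simp: laplacian_eq hit_Suc)
    moreover have "hit G x (Suc n) v = hit G x n v" if "parcs G `` {v} = {}"
      using that v by (simp add: hit_Suc srw_step_def)
    ultimately show False using v that by auto
  qed
  then have "{v. hit G x (Suc n) v \<noteq> 0} \<subseteq> insert x (?S \<union> (\<Union>y\<in>?S. parcs G `` {y}))" by blast
  moreover have "finite (insert x (?S \<union> (\<Union>y\<in>?S. parcs G `` {y})))" using Suc fin by auto
  ultimately show ?case by (rule finite_subset)
qed

text \<open>By \<open>prob_walk_pmf_Suc\<close>, the probability of a return to \<open>x\<close> at
  one of the times 1 to \<open>n + 1\<close>.\<close>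

definition return_by :: "'a \<Rightarrow> nat \<Rightarrow> real" where
  "return_by x n = measure_pmf.expectation (srw_step G x) (hit G x n)"

lemma laplacian_hit_self: "laplacian (hit G x n) x = card (parcs G `` {x}) * (1 - return_by x n)"
  by (simp add: laplacian_eq return_by_def)

lemma laplacian_hit: "v \<noteq> x \<Longrightarrow> laplacian (hit G x n) v = card (parcs G `` {v}) * (hit G x n v - hit G x (Suc n) v)"
  by (simp add: laplacian_eq hit_Suc)

text \<open>By Green's identity the energy is twice the sum of \<open>hit\<close> times its
  Laplacian. Monotonicity in \<open>n\<close> makes the Laplacian nonpositive off \<open>x\<close>,
  so only the term at \<open>x\<close> has to be kept.\<close>

lemma energy_hit_le: "energy G (hit G x n) \<le> 2 * (card (parcs G `` {x}) * (1 - return_by x n))"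
proof -
  let ?w = "hit G x n" and ?S = "{v. hit G x n v \<noteq> 0}"
  have "energy G ?w = 2 * (\<Sum>v\<in>?S. ?w v * laplacian ?w v)"
    using green_identity[of ?S ?w ?w] energy_eq_sum_arcs_at[of ?S ?w] finite_support_hit
    by (simp add: power2_eq_square)
  also have "(\<Sum>v\<in>?S. ?w v * laplacian ?w v) = laplacian ?w x + (\<Sum>v\<in>?S - {x}. ?w v * laplacian ?w v)"
    using finite_support_hit by (subst sum.remove[of _ x]) auto
  also have "(\<Sum>v\<in>?S - {x}. ?w v * laplacian ?w v) \<le> 0"
    using hit_mono hit_bounds(1)
    by (intro sum_nonpos mult_nonneg_nonpos) (auto simp: laplacian_hit mult_nonneg_nonpos)
  finally show ?thesis by (simp add: laplacian_hit_self)
qed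

lemma return_by_tendsto: "return_by x \<longlonglongrightarrow> measure (srw G x) {\<omega>. \<exists>n\<ge>1. \<omega> n = x}"
  unfolding return_by_def by (rule return_prob_tendsto)

text \<open>
  The functions \<^term>\<open>hit G x n\<close> are finitely supported and approximate the equilibrium potential of
  \<open>x\<close>, whose energy is proportional to the escape probability.  This yields both criteria.
\<close>

lemma return_prob_less_1:
  assumes "\<And>f. finite {v. f v \<noteq> 0} \<Longrightarrow> (f x)\<^sup>2 \<le> C * energy G f"
  shows "measure (srw G x) {\<omega>. \<exists>n\<ge>1. \<omega> n = x} < 1"
proof -
  let ?\<rho> = "measure (srw G x) {\<omega>. \<exists>n\<ge>1. \<omega> n = x}" and ?d = "real (card (parcs G `` {x}))"
  have "0 \<le> energy G f" for f by (simp add: energy_def sum_nonneg)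
  then have "(f x)\<^sup>2 \<le> \<bar>C\<bar> * energy G f" if "finite {v. f v \<noteq> 0}" for f
    using assms[OF that] by (meson abs_ge_self mult_right_mono order_trans)
  from this[OF finite_support_hit] have "1 \<le> \<bar>C\<bar> * energy G (hit G x n)" for n
    by (metis hit_self one_power2)
  also have "\<bar>C\<bar> * energy G (hit G x n) \<le> \<bar>C\<bar> * (2 * (?d * (1 - return_by x n)))" for n
    using energy_hit_le by (intro mult_left_mono) auto
  finally have le: "1 \<le> \<bar>C\<bar> * (2 * (?d * (1 - return_by x n)))" for n .
  \<comment> \<open>In the limit, return probability 1 would turn the inequality into
    \<open>1 \<le> 0\<close>.\<close>
  have "(\<lambda>n. \<bar>C\<bar> * (2 * (?d * (1 - return_by x n)))) \<longlonglongrightarrow> \<bar>C\<bar> * (2 * (?d * (1 - ?\<rho>)))"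
    by (intro tendsto_intros return_by_tendsto)
  from LIMSEQ_le_const[OF this] le have "1 \<le> \<bar>C\<bar> * (2 * (?d * (1 - ?\<rho>)))" by blast
  then have "?\<rho> \<noteq> 1" by auto
  moreover have "?\<rho> \<le> 1" using prob_space.prob_le_1[OF prob_space_srw] .
  ultimately show ?thesis by simp
qed

text \<open>Green's identity pairs \<open>f\<close> with \<open>hit G x n\<close>. In the limit only
  the term at \<open>x\<close> survives, giving \<open>y\<close>, twice the degree times the escape
  probability, and Cauchy-Schwarz with \<open>energy_hit_le\<close> yields
  \<open>y\<^sup>2 \<le> \<epsilon> * y\<close>. Hence \<open>y \<le> \<epsilon>\<close> for every
  \<open>\<epsilon> > 0\<close>.\<close>

lemma return_prob_eq_1:
  assumes "\<And>\<epsilon>. \<epsilon> > 0 \<Longrightarrow> \<exists>f. finite {v. f v \<noteq> 0} \<and> f x = 1 \<and> energy G f \<le> \<epsilon>"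
  shows "measure (srw G x) {\<omega>. \<exists>n\<ge>1. \<omega> n = x} = 1"
proof -
  let ?\<rho> = "measure (srw G x) {\<omega>. \<exists>n\<ge>1. \<omega> n = x}" and ?d = "real (card (parcs G `` {x}))"
  have \<rho>1: "?\<rho> \<le> 1" using prob_space.prob_le_1[OF prob_space_srw] .
  have "2 * (?d * (1 - ?\<rho>)) \<le> \<epsilon>" if "\<epsilon> > 0" for \<epsilon>
  proof -
    from assms[OF that] obtain f where f: "finite {v. f v \<noteq> 0}" "f x = 1" "energy G f \<le> \<epsilon>" by blast
    let ?S = "{v. f v \<noteq> 0}"
    have hit_conv: "convergent (\<lambda>n. hit G x n v)" for v
    proof (rule Bseq_monoseq_convergent)
      show "Bseq (\<lambda>n. hit G x n v)" by (rule BseqI'[where K = 1]) (simp add: hit_bounds)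
      show "monoseq (\<lambda>n. hit G x n v)" using hit_mono by (simp add: monoseq_Suc)
    qed
    then have hit_diff: "(\<lambda>n. hit G x n v - hit G x (Suc n) v) \<longlonglongrightarrow> 0" for v
    proof -
      obtain l where l: "(\<lambda>n. hit G x n v) \<longlonglongrightarrow> l" using hit_conv[of v] by (auto simp: convergent_def)
      from tendsto_diff[OF l LIMSEQ_Suc[OF l]] show ?thesis by simp
    qed
    \<comment> \<open>The contribution of the vertices other than \<open>x\<close>. It is a finite
      sum, and each Laplacian in it tends to 0 because it is a multiple of an increment of a
      convergent sequence.\<close>
    define t where "t n = (\<Sum>v\<in>?S - {x}. f v * laplacian (hit G x n) v)" for n
    have "t \<longlonglongrightarrow> (\<Sum>v\<in>?S - {x}. f v * (real (card (parcs G `` {v})) * 0))"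
      unfolding t_def
    proof (intro tendsto_intros)
      fix v assume "v \<in> ?S - {x}"
      then have "v \<noteq> x" by simp
      show "(\<lambda>n. laplacian (hit G x n) v) \<longlonglongrightarrow> real (card (parcs G `` {v})) * 0"
        unfolding laplacian_hit[OF \<open>v \<noteq> x\<close>] by (intro tendsto_intros hit_diff)
    qed
    then have t: "t \<longlonglongrightarrow> 0" by simp
    have le: "(2 * (?d * (1 - return_by x n) + t n))\<^sup>2 \<le> \<epsilon> * (2 * (?d * (1 - return_by x n)))" for n
    proof -
      let ?w = "hit G x n"
      have "(\<Sum>v\<in>?S. f v * laplacian ?w v) = laplacian ?w x + t n"
        using f unfolding t_def by (subst sum.remove[of _ x]) auto
      then have "2 * (?d * (1 - return_by x n) + t n)
          = (\<Sum>a\<in>arcs_at ?S. (f (fst a) - f (snd a)) * (?w (fst a) - ?w (snd a)))"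
        using green_identity[of ?S f ?w] f by (simp add: laplacian_hit_self)
      also have "\<dots>\<^sup>2 \<le> (\<Sum>a\<in>arcs_at ?S. (f (fst a) - f (snd a))\<^sup>2) * (\<Sum>a\<in>arcs_at ?S. (?w (fst a) - ?w (snd a))\<^sup>2)"
        by (rule Cauchy_Schwarz_ineq_sum)
      also have "\<dots> \<le> \<epsilon> * (2 * (?d * (1 - return_by x n)))"
      proof (rule mult_mono)
        show "(\<Sum>a\<in>arcs_at ?S. (f (fst a) - f (snd a))\<^sup>2) \<le> \<epsilon>"
          using energy_eq_sum_arcs_at[of ?S f] f by simp
        have "(\<Sum>a\<in>arcs_at ?S. (?w (fst a) - ?w (snd a))\<^sup>2) \<le> energy G ?w"
          by (rule sum_le_energy[OF finite_support_hit _ finite_arcs_at[OF f(1)]]) (auto simp: arcs_at_def)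
        then show "(\<Sum>a\<in>arcs_at ?S. (?w (fst a) - ?w (snd a))\<^sup>2) \<le> 2 * (?d * (1 - return_by x n))"
          using energy_hit_le by (rule order_trans)
      qed (use that in \<open>auto intro!: sum_nonneg\<close>)
      finally show ?thesis .
    qed
    have "(\<lambda>n. (2 * (?d * (1 - return_by x n) + t n))\<^sup>2) \<longlonglongrightarrow> (2 * (?d * (1 - ?\<rho>) + 0))\<^sup>2"
      by (intro tendsto_intros return_by_tendsto t)
    moreover have "(\<lambda>n. \<epsilon> * (2 * (?d * (1 - return_by x n)))) \<longlonglongrightarrow> \<epsilon> * (2 * (?d * (1 - ?\<rho>)))"
      by (intro tendsto_intros return_by_tendsto)
    ultimately have "(2 * (?d * (1 - ?\<rho>) + 0))\<^sup>2 \<le> \<epsilon> * (2 * (?d * (1 - ?\<rho>)))"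
      by (rule LIMSEQ_le) (use le in auto)
    moreover have "0 \<le> 2 * (?d * (1 - ?\<rho>))" using \<rho>1 by (intro mult_nonneg_nonneg) auto
    moreover have "y \<le> \<epsilon>" if "y\<^sup>2 \<le> \<epsilon> * y" "0 \<le> y" for y
      using that \<open>\<epsilon> > 0\<close> by (cases "y = 0") (auto simp: power2_eq_square)
    ultimately show ?thesis by (simp only: add_0_right)
  qed
  then have "2 * (?d * (1 - ?\<rho>)) \<le> 0"
    by (rule field_le_epsilon) (simp only: add_0_left)
  then have "?d = 0 \<or> ?\<rho> = 1"
    using \<rho>1 by (simp add: mult_le_0_iff) linarith
  then show ?thesis
  proof
    \<comment> \<open>At an isolated vertex the walk stays put, so it returns at time 1.\<close>
    assume "?d = 0"
    then have "parcs G `` {x} = {}" using fin by simp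
    then have "return_by x = (\<lambda>n. 1)" by (simp add: return_by_def srw_step_def fun_eq_iff)
    then have "return_by x \<longlonglongrightarrow> 1" by (simp only: tendsto_const)
    with return_by_tendsto show ?thesis by (rule LIMSEQ_unique)
  qed
qed

end

section \<open>Augmented trees are hyperbolic\<close>

text \<open>The variables stand for Gromov products at one base point. Hyperbolicity for four
  triples compares the three ways of pairing \<open>x\<close>, \<open>y\<close>, \<open>z\<close>,
  \<open>w\<close>.\<close>

lemma four_point_from_triangles:
  fixes xy xz xw yz yw zw \<delta> :: real
  assumes "xz \<ge> min xy yz - \<delta>" "xz \<ge> min xw zw - \<delta>" "yw \<ge> min xy xw - \<delta>" "yw \<ge> min yz zw - \<delta>"
  shows "xz + yw \<ge> min (xy + zw) (yz + xw) - 2 * \<delta>"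
  using assms by (auto simp: min_def split: if_splits)

text \<open>Change of base point at the price of doubling \<open>\<delta>\<close>: the sum of the
  two products of a pairing depends on the base point only through a term common to all pairings, so
  the four-point inequality can be read at any base point.\<close>

lemma gromov_hyperbolicI:
  assumes sym: "\<And>x y. x \<in> pverts G \<Longrightarrow> y \<in> pverts G \<Longrightarrow> graph_dist G x y = graph_dist G y x"
    and o: "o' \<in> pverts G"
    and "\<delta> \<ge> 0"
    and hyp: "\<And>x y z. x \<in> pverts G \<Longrightarrow> y \<in> pverts G \<Longrightarrow> z \<in> pverts G \<Longrightarrow>
      gromov_product G o' x z \<ge> min (gromov_product G o' x y) (gromov_product G o' y z) - \<delta>"
  shows "gromov_hyperbolic G"
  unfolding gromov_hyperbolic_def
proof (intro exI[of _ "2 * \<delta>"] conjI ballI)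
  fix w x y z assume V: "w \<in> pverts G" "x \<in> pverts G" "y \<in> pverts G" "z \<in> pverts G"
  let ?p = "gromov_product G o'"
  have comm: "?p a b = ?p b a" if "a \<in> pverts G" "b \<in> pverts G" for a b
    using that by (simp add: gromov_product_def sym)
  have "min (?p x y + ?p z w) (?p y z + ?p x w) - 2 * \<delta> \<le> ?p x z + ?p y w"
    using hyp[of x y z] hyp[of x w z] hyp[of y x w] hyp[of y z w] V comm
    by (intro four_point_from_triangles) auto
  then show "min (gromov_product G w x y) (gromov_product G w y z) - 2 * \<delta> \<le> gromov_product G w x z"
    using sym V unfolding gromov_product_def by (auto simp: min_def field_simps split: if_splits)
qed (use assms in auto)

lemma sym_relpow: "sym r \<Longrightarrow> (x, y) \<in> r ^^ n \<Longrightarrow> (y, x) \<in> r ^^ n"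
proof (induction n arbitrary: y)
  case (Suc n)
  then obtain z where "(x, z) \<in> r ^^ n" "(z, y) \<in> r" by auto
  then show ?case using Suc by (meson relpow_Suc_I2 symD)
qed auto

text \<open>A rooted tree with horizontal edges inside its levels; reflexivity makes
  \<open>R\<close> mean equal or adjacent. \<open>R_par2\<close> is the contraction behind
  hyperbolicity: two horizontal steps project to at most one. Truncated subtraction in
  \<open>lev_par\<close> makes the root its own parent.\<close>

locale augmented_tree =
  fixes V :: "'a set" and root :: 'a and lev :: "'a \<Rightarrow> nat" and par :: "'a \<Rightarrow> 'a"
    and R :: "'a \<Rightarrow> 'a \<Rightarrow> bool"
  assumes root_V: "root \<in> V"
    and par_V: "v \<in> V \<Longrightarrow> par v \<in> V"
    and lev_par: "v \<in> V \<Longrightarrow> lev (par v) = lev v - 1"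
    and lev_0: "v \<in> V \<Longrightarrow> lev v = 0 \<longleftrightarrow> v = root"
    and R_refl: "v \<in> V \<Longrightarrow> R v v"
    and R_sym: "R u v \<Longrightarrow> R v u"
    and R_lev: "u \<in> V \<Longrightarrow> v \<in> V \<Longrightarrow> R u v \<Longrightarrow> lev u = lev v"
    and R_par2: "u \<in> V \<Longrightarrow> v \<in> V \<Longrightarrow> w \<in> V \<Longrightarrow> R u v \<Longrightarrow> R v w \<Longrightarrow> R (par u) (par w)"
begin

definition E :: "('a \<times> 'a) set" where
  "E = {(u, v). u \<in> V \<and> v \<in> V \<and> u \<noteq> v \<and> (R u v \<or> u = par v \<or> v = par u)}"

text \<open>Unlike \<open>E\<close> this keeps the loops on \<open>V\<close>, so that
  \<open>H ^^ h\<close> covers all horizontal walks of at most \<open>h\<close> steps.\<close>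

definition H :: "('a \<times> 'a) set" where
  "H = {(u, v). u \<in> V \<and> v \<in> V \<and> R u v}"

definition anc :: "nat \<Rightarrow> 'a \<Rightarrow> 'a" where
  "anc m x = (par ^^ (lev x - m)) x"

lemma lev_root: "lev root = 0" and par_root: "par root = root"
  using lev_0[OF root_V] lev_par[OF root_V] lev_0[OF par_V[OF root_V]] by auto

lemma funpow_par_V: "x \<in> V \<Longrightarrow> (par ^^ k) x \<in> V"
  by (induction k) (auto intro: par_V)

lemma lev_funpow_par: "x \<in> V \<Longrightarrow> lev ((par ^^ k) x) = lev x - k"
  by (induction k) (auto simp: lev_par funpow_par_V)

lemma anc_V: "x \<in> V \<Longrightarrow> anc m x \<in> V"
  by (simp add: anc_def funpow_par_V)

lemma lev_anc: "x \<in> V \<Longrightarrow> m \<le> lev x \<Longrightarrow> lev (anc m x) = m"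
  by (simp add: anc_def lev_funpow_par)

lemma anc_lev [simp]: "anc (lev x) x = x"
  by (simp add: anc_def)

lemma par_anc: "x \<in> V \<Longrightarrow> m < lev x \<Longrightarrow> par (anc (Suc m) x) = anc m x"
  by (simp add: anc_def Suc_diff_Suc flip: funpow.simps(2)[unfolded o_def, THEN fun_cong])

lemma anc_par: "x \<in> V \<Longrightarrow> m < lev x \<Longrightarrow> anc m (par x) = anc m x"
  by (simp add: anc_def lev_par funpow_swap1[symmetric] flip: Suc_diff_Suc)

lemma anc_0: "x \<in> V \<Longrightarrow> anc 0 x = root"
  using lev_0[OF anc_V, of x 0] lev_anc[of x 0] by simp

lemma H_par: "(u, v) \<in> H \<Longrightarrow> (par u, par v) \<in> H"
  using R_par2 R_refl par_V unfolding H_def by blast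

text \<open>Steps are grouped in pairs, each of which \<open>R_par2\<close> projects to one step; a
  single step left over projects by \<open>H_par\<close>.\<close>

lemma H_par_relpow: "(u, v) \<in> H ^^ h \<Longrightarrow> (par u, par v) \<in> H ^^ ((h + 1) div 2)"
proof (induction h arbitrary: u rule: less_induct)
  case (less h)
  consider "h = 0" | "h = 1" | k where "h = Suc (Suc k)"
    by (metis One_nat_def not0_implies_Suc)
  then show ?case
  proof cases
    case 3
    with less.prems obtain w z where "(u, w) \<in> H" "(w, z) \<in> H" "(z, v) \<in> H ^^ k"
      by (metis relpow_Suc_D2)
    then have "(par u, par z) \<in> H" "(par z, par v) \<in> H ^^ ((k + 1) div 2)"
      using less.IH 3 R_par2 par_V unfolding H_def by auto
    then have "(par u, par v) \<in> H ^^ Suc ((k + 1) div 2)" by (rule relpow_Suc_I2)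
    moreover have "(h + 1) div 2 = Suc ((k + 1) div 2)" using 3 by simp
    ultimately show ?thesis by (simp only:)
  qed (use less.prems H_par in auto)
qed

text \<open>
  Here \<open>m\<close> is the least level on the walk, to which the walk is projected, and \<open>h\<close> is what remains of
  its horizontal steps.
\<close>

lemma walk_projects:
  assumes "(x, y) \<in> E ^^ n" "x \<in> V"
  shows "\<exists>m h. y \<in> V \<and> m \<le> lev x \<and> m \<le> lev y \<and> lev x + lev y + h \<le> n + 2 * m \<and> (anc m x, anc m y) \<in> H ^^ h"
  using assms
proof (induction n arbitrary: y)
  case 0
  then show ?case by (intro exI[of _ "lev x"] exI[of _ 0]) auto
next
  case (Suc n)
  then obtain z where z: "(x, z) \<in> E ^^ n" "(z, y) \<in> E" by auto
  from Suc.IH[OF z(1) Suc.prems(2)] obtain m h where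
    IH: "z \<in> V" "m \<le> lev x" "m \<le> lev z" "lev x + lev z + h \<le> n + 2 * m" "(anc m x, anc m z) \<in> H ^^ h"
    by blast
  have y: "y \<in> V" using z(2) by (auto simp: E_def)
  consider "R z y" | "z = par y" "lev y > 0" | "y = par z" "lev z > 0"
    using z(2) par_root lev_0 unfolding E_def by force
  then show ?case
  proof cases
    case 1
    then have lev: "lev y = lev z" using R_lev IH(1) y by auto
    have "(anc m z, anc m y) \<in> H"
      using \<open>m \<le> lev z\<close>
    proof (induction m rule: inc_induct)
      case base
      show ?case using 1 IH(1) y lev by (metis (mono_tags, lifting) H_def anc_lev case_prodI mem_Collect_eq)
    next
      case (step m)
      then show ?case using H_par[of "anc (Suc m) z" "anc (Suc m) y"] par_anc IH(1) y lev by simp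
    qed
    then have "(anc m x, anc m y) \<in> H ^^ Suc h" using IH(5) by auto
    then show ?thesis using IH y lev by (intro exI[of _ m] exI[of _ "Suc h"]) auto
  next
    case 2
    then have "lev z = lev y - 1" "anc m y = anc m z"
      using lev_par[OF y] anc_par[OF y, of m] IH(3) by auto
    then show ?thesis using IH y 2 by (intro exI[of _ m] exI[of _ h]) auto
  next
    case 3
    have lev: "lev y = lev z - 1" using lev_par IH(1) 3 by simp
    show ?thesis
    proof (cases "m = lev z")
      case True
      \<comment> \<open>The step up leaves level \<open>m\<close>, so the projection moves up as
        well. Both sides of the length bound then drop by one, and
        \<open>(h + 1) div 2 \<le> h\<close> does the rest.\<close>
      then have m: "m = Suc (lev y)" using lev 3 by simp
      have "(par (anc m x), par (anc m z)) \<in> H ^^ ((h + 1) div 2)" using IH(5) by (rule H_par_relpow)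
      then have "(anc (lev y) x, anc (lev y) y) \<in> H ^^ ((h + 1) div 2)"
        using par_anc[OF Suc.prems(2), of "lev y"] IH(2) m 3(1) by (simp add: True)
      then show ?thesis
        using IH y m lev by (intro exI[of _ "lev y"] exI[of _ "(h + 1) div 2"]) auto
    next
      case False
      then have "anc m y = anc m z" using anc_par[OF IH(1), of m] IH(3) 3 by simp
      then show ?thesis using IH y 3 lev False by (intro exI[of _ m] exI[of _ h]) auto
    qed
  qed
qed

text \<open>Every level climbed halves the horizontal walk, so after \<open>j\<close> levels at most
  one step is left, unless the root is reached before.\<close>

lemma relpow_H_meet:
  assumes "(anc m x, anc m y) \<in> H ^^ h" "h \<le> 2 ^ j" "x \<in> V" "y \<in> V" "m \<le> lev x" "m \<le> lev y"
  shows "\<exists>k\<le>m. m \<le> k + j \<and> (anc k x, anc k y) \<in> H"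
  using assms
proof (induction j arbitrary: m h)
  case 0
  then have "h = 0 \<or> h = 1" by auto
  then have "(anc m x, anc m y) \<in> H" using 0 anc_V R_refl by (auto simp: H_def)
  then show ?case by auto
next
  case (Suc j)
  show ?case
  proof (cases m)
    case 0
    then show ?thesis using Suc.prems anc_0 R_refl root_V by (auto simp: H_def)
  next
    case (Suc m')
    have "(anc m' x, anc m' y) \<in> H ^^ ((h + 1) div 2)"
      using H_par_relpow[OF Suc.prems(1)] Suc.prems Suc par_anc by auto
    then have "\<exists>k\<le>m'. m' \<le> k + j \<and> (anc k x, anc k y) \<in> H"
      using Suc.prems Suc by (intro Suc.IH) auto
    then show ?thesis using Suc by (auto intro: le_SucI)
  qed
qed

text \<open>Climbing \<open>j\<close> levels costs \<open>2 * j\<close> in the bound of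
  \<open>walk_length_lower\<close>; the \<open>h\<close> horizontal steps saved pay for this up to
  the constant 2.\<close>

lemma exists_log: "\<exists>j. h \<le> 2 ^ j \<and> 2 * j \<le> h + 2"
proof (induction h)
  case (Suc h)
  then obtain j where j: "h \<le> 2 ^ j" "2 * j \<le> h + 2" by blast
  have "2 * j \<le> 2 ^ j + 1" 
  proof (cases j)
    case (Suc i)
    then show ?thesis using less_exp[of i] unfolding Suc power_Suc by presburger
  qed simp
  then show ?case
    using j by (cases "h = 2 ^ j") (force intro: exI[of _ "Suc j"], force intro: exI[of _ j])
qed (auto intro: exI[of _ 0])

lemma walk_length_lower:
  assumes "(x, y) \<in> E ^^ n" "x \<in> V"
  obtains k where "k \<le> lev x" "k \<le> lev y" "(anc k x, anc k y) \<in> H" "lev x + lev y \<le> n + 2 * k + 2"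
proof -
  from walk_projects[OF assms] obtain m h where
    m: "y \<in> V" "m \<le> lev x" "m \<le> lev y" "lev x + lev y + h \<le> n + 2 * m" "(anc m x, anc m y) \<in> H ^^ h"
    by blast
  obtain j where j: "h \<le> 2 ^ j" "2 * j \<le> h + 2" using exists_log by blast
  obtain k where "k \<le> m" "m \<le> k + j" "(anc k x, anc k y) \<in> H"
    using relpow_H_meet[OF m(5) j(1) assms(2) m(1-3)] by blast
  then show ?thesis using m j by (intro that[of k]) auto
qed

lemma sym_E: "sym E"
  using R_sym by (auto simp: sym_def E_def)

lemma walk_to_anc: "x \<in> V \<Longrightarrow> k \<le> lev x \<Longrightarrow> (x, anc k x) \<in> E ^^ (lev x - k)"
proof (induction "lev x - k" arbitrary: k)
  case 0
  then show ?case by (simp add: anc_def)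
next
  case (Suc n)
  have n: "n = lev x - Suc k" "Suc k \<le> lev x" using Suc.hyps(2) by auto
  have "(x, anc (Suc k) x) \<in> E ^^ n" using Suc.hyps(1)[OF n(1) Suc.prems(1) n(2)] n(1) by simp
  moreover have "(anc (Suc k) x, anc k x) \<in> E"
    using par_anc[of x k] anc_V[of x] lev_anc[of x k] lev_anc[of x "Suc k"] Suc.prems Suc.hyps(2) unfolding E_def by force
  ultimately have "(x, anc k x) \<in> E ^^ Suc n" by (rule relpow_Suc_I)
  then show ?case using Suc.hyps(2) by (simp only:)
qed

text \<open>Up to level \<open>k\<close>, at most one horizontal step, and down again. Together with
  \<open>walk_length_lower\<close> this determines distances up to an additive constant.\<close>

lemma walk_length_upper:
  assumes "x \<in> V" "y \<in> V" "k \<le> lev x" "k \<le> lev y" "(anc k x, anc k y) \<in> H"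
  shows "\<exists>n. (x, y) \<in> E ^^ n \<and> n + 2 * k \<le> lev x + lev y + 1"
proof -
  have down: "(anc k y, y) \<in> E ^^ (lev y - k)"
    by (rule sym_relpow[OF sym_E walk_to_anc[OF assms(2,4)]])
  have "\<exists>i\<le>1. (anc k x, anc k y) \<in> E ^^ i"
  proof (cases "anc k x = anc k y")
    case False
    then have "(anc k x, anc k y) \<in> E" using assms(5) by (auto simp: H_def E_def)
    then show ?thesis by (intro exI[of _ 1]) auto
  qed auto
  then obtain i where "i \<le> 1" "(anc k x, anc k y) \<in> E ^^ i" by blast
  then have "(x, y) \<in> E ^^ (lev x - k + i + (lev y - k))"
    using walk_to_anc[OF assms(1,3)] down by (auto simp: relpow_add)
  then show ?thesis using assms \<open>i \<le> 1\<close> by (intro exI[of _ "lev x - k + i + (lev y - k)"]) auto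
qed

section \<open>Distances and Gromov products in an augmented tree\<close>

definition dist_E :: "'a \<Rightarrow> 'a \<Rightarrow> nat" where
  "dist_E x y = (LEAST n. (x, y) \<in> E ^^ n)"

lemma dist_E_walk: "x \<in> V \<Longrightarrow> y \<in> V \<Longrightarrow> (x, y) \<in> E ^^ dist_E x y"
proof -
  assume V: "x \<in> V" "y \<in> V"
  then have "(anc 0 x, anc 0 y) \<in> H" using anc_0 R_refl root_V by (simp add: H_def)
  from walk_length_upper[OF V le0 le0 this] obtain n where "(x, y) \<in> E ^^ n" by blast
  then show ?thesis unfolding dist_E_def by (rule LeastI)
qed

lemma dist_E_le: "(x, y) \<in> E ^^ n \<Longrightarrow> dist_E x y \<le> n"
  unfolding dist_E_def by (rule Least_le)

lemma dist_E_commute: "dist_E x y = dist_E y x"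
  unfolding dist_E_def by (rule arg_cong[where f = Least]) (auto intro: sym_relpow[OF sym_E])

lemma dist_E_root: "x \<in> V \<Longrightarrow> dist_E x root = lev x"
proof (rule antisym)
  assume x: "x \<in> V"
  show "dist_E x root \<le> lev x"
    using walk_to_anc[OF x, of 0] anc_0[OF x] by (intro dist_E_le) simp
  show "lev x \<le> dist_E x root"
    using walk_projects[OF dist_E_walk[OF x root_V] x] lev_root by auto
qed

text \<open>By \<open>dist_E_root\<close>, \<open>p\<close> is the Gromov product at the root. It
  exceeds a level where the ancestors meet by at most 1. At the smaller level \<open>m\<close> of
  the two given, the ancestors of \<open>x\<close> and \<open>z\<close> are two horizontal steps
  apart, hence at most one step apart on level \<open>m - 1\<close>, so
  \<open>p x z \<ge> m - 3 / 2\<close>; the two errors add up to \<open>5 / 2\<close>.\<close>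

lemma dist_E_hyperbolic:
  assumes V: "x \<in> V" "y \<in> V" "z \<in> V"
  defines "p \<equiv> \<lambda>a b. (real (lev a) + real (lev b) - real (dist_E a b)) / 2"
  shows "p x z \<ge> min (p x y) (p y z) - 5 / 2"
proof -
  have p_le: "\<exists>k. k \<le> lev a \<and> k \<le> lev b \<and> (anc k a, anc k b) \<in> H \<and> p a b \<le> real k + 1" if ab: "a \<in> V" "b \<in> V" for a b
  proof -
    obtain k where "k \<le> lev a" "k \<le> lev b" "(anc k a, anc k b) \<in> H" "lev a + lev b \<le> dist_E a b + 2 * k + 2"
      using walk_length_lower[OF dist_E_walk[OF ab] ab(1)] by blast
    then show ?thesis by (intro exI[of _ k]) (auto simp: p_def)
  qed
  obtain k where k: "k \<le> lev x" "k \<le> lev y" "(anc k x, anc k y) \<in> H" "p x y \<le> real k + 1" using p_le V by blast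
  obtain l where l: "l \<le> lev y" "l \<le> lev z" "(anc l y, anc l z) \<in> H" "p y z \<le> real l + 1" using p_le V by blast
  define m where "m = min k l"
  have H_anc: "(anc i a, anc i b) \<in> H" if "i \<le> j" "(anc j a, anc j b) \<in> H" "a \<in> V" "b \<in> V" "j \<le> lev a" "j \<le> lev b" for i j a b
    using that(1)
  proof (induction i rule: inc_induct)
    case (step i)
    then show ?case using H_par[of "anc (Suc i) a" "anc (Suc i) b"] par_anc that by simp
  qed (use that in simp)
  have m: "m \<le> k" "m \<le> l" by (auto simp: m_def)
  have mm: "(anc m x, anc m y) \<in> H" "(anc m y, anc m z) \<in> H"
    using H_anc[OF m(1) k(3)] H_anc[OF m(2) l(3)] V k l by auto
  have "(anc (m - 1) x, anc (m - 1) z) \<in> H"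
  proof (cases m)
    case 0
    then show ?thesis using V anc_0 root_V R_refl by (simp add: H_def)
  next
    case (Suc i)
    then have "(par (anc m x), par (anc m z)) \<in> H" using mm R_par2 par_V unfolding H_def by blast
    then show ?thesis using Suc par_anc[of x i] par_anc[of z i] V m k l by simp
  qed
  then obtain n where "(x, z) \<in> E ^^ n" "n + 2 * (m - 1) \<le> lev x + lev z + 1"
    using walk_length_upper[OF V(1,3), of "m - 1"] k(1) l(2) m by (meson diff_le_self order_trans)
  then have "dist_E x z + 2 * (m - 1) \<le> lev x + lev z + 1"
    using dist_E_le[of x z n] by linarith
  then have "p x z \<ge> real m - 3 / 2" by (simp add: p_def)
  moreover have "min (p x y) (p y z) \<le> real m + 1" using k(4) l(4) by (auto simp: m_def min_def)
  ultimately show ?thesis by simp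
qed

end

section \<open>Recurrence of trees\<close>

context locally_finite_graph
begin

text \<open>The test function behind the Nash-Williams criterion.\<close>

lemma cutset_energy:
  fixes S :: "'k \<Rightarrow> 'a set" and B :: "'k \<Rightarrow> ('a \<times> 'a) set" and w :: "'k \<Rightarrow> real"
  assumes K: "finite K" and S: "\<And>k. k \<in> K \<Longrightarrow> finite (S k)" "\<And>k. k \<in> K \<Longrightarrow> x \<in> S k"
    and B: "\<And>k. k \<in> K \<Longrightarrow> finite (B k)" "\<And>k. k \<in> K \<Longrightarrow> B k \<subseteq> parcs G"
    and cut: "\<And>k u v. k \<in> K \<Longrightarrow> (u, v) \<in> parcs G \<Longrightarrow> u \<in> S k \<longleftrightarrow> v \<notin> S k \<Longrightarrow> (u, v) \<in> B k"
    and disj: "\<And>j k. j \<in> K \<Longrightarrow> k \<in> K \<Longrightarrow> j \<noteq> k \<Longrightarrow> B j \<inter> B k = {}"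
    and w: "\<And>k. k \<in> K \<Longrightarrow> 0 \<le> w k" "sum w K = 1"
  shows "\<exists>f. finite {v. f v \<noteq> 0} \<and> f x = 1 \<and> energy G f \<le> (\<Sum>k\<in>K. card (B k) * (w k)\<^sup>2)"
proof (intro exI conjI)
  \<comment> \<open>Since the cutsets are disjoint, only the \<open>k\<close>-th summand can jump
    along an arc of \<open>B k\<close>, and it jumps by at most \<open>w k\<close>.\<close>
  define f where "f v = (\<Sum>k\<in>K. w k * indicator (S k) v)" for v
  have "{v. f v \<noteq> 0} \<subseteq> (\<Union>k\<in>K. S k)"
    unfolding f_def by (auto elim!: sum.not_neutral_contains_not_neutral simp: indicator_def split: if_splits)
  then show "finite {v. f v \<noteq> 0}" by (rule finite_subset) (use K S in auto)
  show "f x = 1" using S w by (simp add: f_def indicator_def)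
  have diff0: "w k * indicator (S k) u - w k * indicator (S k) v = 0"
    if "k \<in> K" "(u, v) \<in> parcs G" "(u, v) \<notin> B k" for k u v
    using cut[OF that(1,2)] that by (auto simp: indicator_def)
  have "energy G f = (\<Sum>a\<in>(\<Union>k\<in>K. B k). (f (fst a) - f (snd a))\<^sup>2)"
  proof (rule energy_eq_sum)
    show "a \<in> (\<Union>k\<in>K. B k)" if "a \<in> parcs G" "f (fst a) \<noteq> f (snd a)" for a
    proof (rule ccontr)
      assume "a \<notin> (\<Union>k\<in>K. B k)"
      then have "f (fst a) - f (snd a) = 0"
        unfolding f_def sum_subtractf[symmetric] using that(1) by (intro sum.neutral ballI diff0) auto
      then show False using that by simp
    qed
  qed (use K B in auto)
  also have "\<dots> = (\<Sum>k\<in>K. \<Sum>a\<in>B k. (f (fst a) - f (snd a))\<^sup>2)"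
    using K B disj by (intro sum.UNION_disjoint) auto
  also have "\<dots> \<le> (\<Sum>k\<in>K. \<Sum>a\<in>B k. (w k)\<^sup>2)"
  proof (intro sum_mono)
    fix k a assume k: "k \<in> K" and a: "a \<in> B k"
    obtain u v where uv: "a = (u, v)" by (cases a)
    have G: "(u, v) \<in> parcs G" using B k a uv by auto
    have "f u - f v = (\<Sum>j\<in>{k}. w j * indicator (S j) u - w j * indicator (S j) v)"
      unfolding f_def sum_subtractf[symmetric]
    proof (rule sum.mono_neutral_right[OF K])
      show "\<forall>j\<in>K - {k}. w j * indicator (S j) u - w j * indicator (S j) v = 0"
        using disj k a uv G by (intro ballI diff0) auto
    qed (use k in auto)
    then have "\<bar>f u - f v\<bar> \<le> w k" using w(1)[OF k] by (auto simp: indicator_def)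
    then have "\<bar>f u - f v\<bar>\<^sup>2 \<le> (w k)\<^sup>2" by (intro power_mono) auto
    then show "(f (fst a) - f (snd a))\<^sup>2 \<le> (w k)\<^sup>2" by (simp add: uv)
  qed
  finally show "energy G f \<le> (\<Sum>k\<in>K. card (B k) * (w k)\<^sup>2)" by simp
qed

end

text \<open>A shortest walk from \<open>r\<close> to \<open>l\<close> has a step from level
  \<open>k\<close> to \<open>Suc k\<close>. That edge is a bridge, and the rest of the walk avoids
  it, so deleting it disconnects \<open>r\<close> from \<open>l\<close>.\<close>

lemma separating_edge:
  fixes E :: "'a rel" and lev :: "'a \<Rightarrow> nat"
  assumes bridge: "\<And>u v. (u, v) \<in> E \<Longrightarrow> (u, v) \<notin> (E - {(u, v), (v, u)})\<^sup>*"
    and "sym E" and step: "\<And>u v. (u, v) \<in> E \<Longrightarrow> lev v \<le> Suc (lev u)"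
    and rl: "(r, l) \<in> E\<^sup>*" "lev r \<le> k" "k < lev l"
  shows "\<exists>u v. (u, v) \<in> E \<and> lev u = k \<and> lev v = Suc k \<and> (r, l) \<notin> (E - {(u, v), (v, u)})\<^sup>*"
proof -
  \<comment> \<open>Minimal length makes the vertices of the walk distinct, so it uses no edge
    twice.\<close>
  define n where "n = (LEAST n. (r, l) \<in> E ^^ n)"
  have "\<exists>n. (r, l) \<in> E ^^ n" using rl(1) by (rule rtrancl_imp_relpow)
  then have "(r, l) \<in> E ^^ n" unfolding n_def by (rule LeastI_ex)
  then obtain f where f: "f 0 = r" "f n = l" "\<And>i. i < n \<Longrightarrow> (f i, f (Suc i)) \<in> E"
    unfolding relpow_fun_conv by blast
  have seg: "(f i, f j) \<in> E' ^^ (j - i)" if "i \<le> j" "\<And>m. i \<le> m \<Longrightarrow> m < j \<Longrightarrow> (f m, f (Suc m)) \<in> E'" for i j E'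
    unfolding relpow_fun_conv using that by (intro exI[of _ "\<lambda>m. f (i + m)"]) auto
  have inj: "f i \<noteq> f j" if "i < j" "j \<le> n" for i j
  proof
    assume eq: "f i = f j"
    have "(f 0, f i) \<in> E ^^ (i - 0)" using f that by (intro seg) auto
    moreover have "(f j, f n) \<in> E ^^ (n - j)" using f that by (intro seg) auto
    ultimately have "(r, l) \<in> E ^^ (i + (n - j))" unfolding relpow_add using eq f by auto
    then have "n \<le> i + (n - j)" unfolding n_def by (rule Least_le)
    then show False using that by simp
  qed
  \<comment> \<open>The first vertex above level \<open>k\<close>; levels rise by at most one per
    step, so its predecessor is exactly on level \<open>k\<close>.\<close>
  define j where "j = (LEAST j. k < lev (f j))"
  have "k < lev (f n)" using rl f by simp
  then have j: "k < lev (f j)" "j \<le> n" unfolding j_def by (rule LeastI, rule Least_le)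
  have "j \<noteq> 0" using j(1) f rl by (cases j) auto
  then obtain i where i: "j = Suc i" by (cases j) auto
  have "lev (f i) \<le> k" using not_less_Least[of i "\<lambda>j. k < lev (f j)"] i unfolding j_def[symmetric] by simp
  moreover have "(f i, f (Suc i)) \<in> E" using f i j by auto
  ultimately have lev: "lev (f i) = k" "lev (f (Suc i)) = Suc k" using step[of "f i" "f (Suc i)"] j i by auto
  let ?E' = "E - {(f i, f (Suc i)), (f (Suc i), f i)}"
  have ne: "(f m, f (Suc m)) \<in> ?E'" if "m < n" "m \<noteq> i" for m
  proof -
    have "f m \<noteq> f i" using inj[of m i] inj[of i m] that i j by (cases "m < i") auto
    moreover have "f m \<noteq> f (Suc i) \<or> f (Suc m) \<noteq> f i"
      using inj[of m "Suc i"] inj[of i "Suc m"] that i j by (cases "m < i") auto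
    ultimately show ?thesis using f that by auto
  qed
  have ri: "(f 0, f i) \<in> ?E'\<^sup>*" using i j by (intro relpow_imp_rtrancl[OF seg] ne) auto
  have il: "(f (Suc i), f n) \<in> ?E'\<^sup>*" using i j by (intro relpow_imp_rtrancl[OF seg] ne) auto
  have "sym ?E'" using \<open>sym E\<close> by (auto simp: sym_def)
  then have sym': "sym (?E'\<^sup>*)" by (rule sym_rtrancl)
  have "(r, l) \<notin> ?E'\<^sup>*"
  proof
    assume "(r, l) \<in> ?E'\<^sup>*"
    then have "(f i, f (Suc i)) \<in> ?E'\<^sup>*"
      using ri il sym' f by (metis rtrancl_trans symD)
    then show False using bridge \<open>(f i, f (Suc i)) \<in> E\<close> by blast
  qed
  then show ?thesis using lev \<open>(f i, f (Suc i)) \<in> E\<close> by blast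
qed

lemma rtrancl_on_eq:
  assumes "r \<subseteq> F \<times> F" "u \<in> F"
  shows "(u, v) \<in> rtrancl_on F r \<longleftrightarrow> (u, v) \<in> r\<^sup>*"
proof
  show "(u, v) \<in> rtrancl_on F r \<Longrightarrow> (u, v) \<in> r\<^sup>*"
    by (induction rule: rtrancl_on_induct) (auto intro: rtrancl.rtrancl_into_rtrancl)
  assume "(u, v) \<in> r\<^sup>*"
  then show "(u, v) \<in> rtrancl_on F r"
    by (induction rule: rtrancl_induct) (use assms in \<open>auto intro: rtrancl_on_into_rtrancl_on\<close>)
qed

lemma connected_with_proj_iff:
  assumes "pair_sym_digraph G"
  shows "Digraph_Component.connected (with_proj G) \<longleftrightarrow>
    pverts G \<noteq> {} \<and> (\<forall>u\<in>pverts G. \<forall>v\<in>pverts G. (u, v) \<in> (parcs G)\<^sup>*)"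
proof -
  interpret pair_sym_digraph G by fact
  have "symcl (parcs G) = parcs G" by (auto simp: symcl_def intro: arcs_symmetric)
  moreover have "parcs G \<subseteq> pverts G \<times> pverts G" by (auto intro: in_arcsD1 in_arcsD2)
  ultimately show ?thesis unfolding connected_conv by (simp add: rtrancl_on_eq)
qed

text \<open>A detour around the edge can be taken with distinct vertices; the arc
  \<open>(v, u)\<close> closes it to a cycle.\<close>

lemma undirected_tree_bridge:
  assumes "undirected_tree T" "(u, v) \<in> parcs T"
  shows "(u, v) \<notin> (parcs T - {(u, v), (v, u)})\<^sup>*"
proof
  interpret T: pair_bidirected_digraph T using assms by (simp add: undirected_tree_def)
  define T' where "T' = \<lparr>pverts = pverts T, parcs = parcs T - {(u, v), (v, u)}\<rparr>"
  interpret T': pair_wf_digraph T'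
    by unfold_locales (auto simp: T'_def intro: T.in_arcsD1 T.in_arcsD2)
  assume "(u, v) \<in> (parcs T - {(u, v), (v, u)})\<^sup>*"
  then have "(u, v) \<in> rtrancl_on (pverts T') (parcs T')"
    using T.in_arcsD1[OF assms(2)] T.in_arcsD1 T.in_arcsD2
    by (subst rtrancl_on_eq) (auto simp: T'_def)
  then have "reachable (with_proj T') u v" by (simp add: reachable_def)
  then obtain p where p: "T'.apath u p v" unfolding T'.reachable_apath by blast
  have ne: "u \<noteq> v" using T.pair_no_loops[OF assms(2)] by auto
  have p': "T'.awalk u p v" "distinct (pawalk_verts u p)"
    using p by (auto simp: T'.apath_def)
  then have "u \<in> pverts T'" "set p \<subseteq> parcs T'" and cas: "pcas u p v"
    by (auto simp: T'.awalk_def)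
  then have w: "u \<in> pverts T" "set p \<subseteq> parcs T - {(u, v), (v, u)}"
    by (simp_all add: T'_def)
  have cas_append: "pcas x (q @ [(y, z)]) z" "pawalk_verts x (q @ [(y, z)]) = pawalk_verts x q @ [z]"
    if "pcas x q y" for x y z :: 'a and q
    using that by (induction q arbitrary: x) auto
  have "hd (pawalk_verts u p) = u" "pawalk_verts u p \<noteq> []" using cas by (cases p; auto)+
  then obtain ys where ys: "pawalk_verts u p = u # ys" by (cases "pawalk_verts u p") auto
  have "T.awalk u (p @ [(v, u)]) u"
    using w cas_append(1)[OF cas] T.arcs_symmetric[OF assms(2)] by (auto simp: T.awalk_def)
  moreover have "distinct (tl (pawalk_verts u (p @ [(v, u)])))"
    using p'(2) unfolding cas_append(2)[OF cas] ys by simp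
  ultimately have "T.cycle (p @ [(v, u)])" by (auto simp: T.cycle_def)
  \<comment> \<open>The detour is not empty as \<open>u \<noteq> v\<close>, and it is not a single
    arc as \<open>(u, v)\<close> was removed.\<close>
  moreover have "length (p @ [(v, u)]) \<ge> 3"
  proof (cases p)
    case Nil
    then show ?thesis using cas ne by simp
  next
    case (Cons e q)
    then show ?thesis using cas w by (cases q; cases e) auto
  qed
  ultimately show False using assms(1) unfolding undirected_tree_def by blast
qed

text \<open>Addresses with suffix \<open>\<tau>\<close> make up the part at and below block
  \<open>\<tau>\<close>: it is entered only at \<open>rt \<tau>\<close>, and the blocks strictly
  below only from \<open>lf \<tau>\<close>. For \<open>n\<close> large and \<open>i < 2 ^ n\<close>,
  deleting in each traversable block of generation \<open>n\<close> a cut edge at height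
  \<open>i\<close> confines the component of \<open>x\<close> to a finite set. These cutsets are fed
  into \<open>cutset_energy\<close>.\<close>

lemma undirected_tree_not_transient:
  fixes T :: "'a::countable pair_pre_digraph" and lev :: "'a \<Rightarrow> nat" and addr :: "'a \<Rightarrow> bool list"
  assumes tree: "undirected_tree T"
    and fin: "\<And>v. finite (parcs T `` {v})"
    and lev_step: "\<And>u v. (u, v) \<in> parcs T \<Longrightarrow> lev v \<le> Suc (lev u)"
    and enter: "\<And>u v \<tau>. (u, v) \<in> parcs T \<Longrightarrow> \<not> suffix \<tau> (addr u) \<Longrightarrow> suffix \<tau> (addr v) \<Longrightarrow> v = rt \<tau>"
    and leave: "\<And>u v \<tau>. (u, v) \<in> parcs T \<Longrightarrow> \<not> strict_suffix \<tau> (addr u) \<Longrightarrow> strict_suffix \<tau> (addr v) \<Longrightarrow> u = lf \<tau>"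
    and lev_rt: "\<And>\<tau>. lev (rt \<tau>) = N (length \<tau>)"
    and lev_lf: "\<And>\<tau>. lev (lf \<tau>) = N (length \<tau>) + 2 ^ length \<tau>"
    and N_Suc: "\<And>n. N (Suc n) = N n + 2 ^ n + 1"
    and fin_levels: "\<And>n. finite {v \<in> pverts T. length (addr v) \<le> n}"
  shows "\<not> transient T"
proof -
  interpret T: pair_bidirected_digraph T using tree by (simp add: undirected_tree_def)
  have ps: "pair_sym_digraph T" by unfold_locales
  interpret locally_finite_graph T
    by unfold_locales (use T.arcs_symmetric fin in auto)
  define E where "E = parcs T"
  have symE: "sym E" using sym by (auto simp: sym_def E_def)
  obtain x where x: "x \<in> pverts T" and conn: "\<And>u v. u \<in> pverts T \<Longrightarrow> v \<in> pverts T \<Longrightarrow> (u, v) \<in> E\<^sup>*"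
    using tree unfolding undirected_tree_def connected_with_proj_iff[OF ps] E_def by blast
  \<comment> \<open>Only a block with both terminals in the tree can be traversed.\<close>
  define used where "used n = {\<tau>. length \<tau> = n \<and> rt \<tau> \<in> pverts T \<and> lf \<tau> \<in> pverts T}" for n
  define sep where "sep n i \<tau> e \<longleftrightarrow> e \<in> E \<and> lev (fst e) = N n + i \<and> lev (snd e) = Suc (N n + i) \<and>
      (rt \<tau>, lf \<tau>) \<notin> (E - {e, prod.swap e})\<^sup>*" for n i \<tau> e
  have ex_sep: "\<exists>e. sep n i \<tau> e" if "\<tau> \<in> used n" "i < 2 ^ n" for n i \<tau>
  proof -
    have "\<exists>u v. (u, v) \<in> E \<and> lev u = N n + i \<and> lev v = Suc (N n + i) \<and>
        (rt \<tau>, lf \<tau>) \<notin> (E - {(u, v), (v, u)})\<^sup>*"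
    proof (rule separating_edge)
      show "(u, v) \<notin> (E - {(u, v), (v, u)})\<^sup>*" if "(u, v) \<in> E" for u v
        using undirected_tree_bridge[OF tree] that by (simp add: E_def)
      show "lev v \<le> Suc (lev u)" if "(u, v) \<in> E" for u v using lev_step that by (simp add: E_def)
      show "(rt \<tau>, lf \<tau>) \<in> E\<^sup>*" using conn that by (simp add: used_def)
      show "lev (rt \<tau>) \<le> N n + i" "N n + i < lev (lf \<tau>)"
        using that lev_rt lev_lf by (simp_all add: used_def)
    qed (rule symE)
    then obtain u v where "(u, v) \<in> E" "lev u = N n + i" "lev v = Suc (N n + i)"
      "(rt \<tau>, lf \<tau>) \<notin> (E - {(u, v), (v, u)})\<^sup>*"
      by blast
    then have "sep n i \<tau> (u, v)" by (simp add: sep_def)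
    then show ?thesis by blast
  qed
  define e where "e n i \<tau> = (SOME e. sep n i \<tau> e)" for n i \<tau>
  have e: "e n i \<tau> \<in> E" "lev (fst (e n i \<tau>)) = N n + i" "lev (snd (e n i \<tau>)) = Suc (N n + i)"
      "(rt \<tau>, lf \<tau>) \<notin> (E - {e n i \<tau>, prod.swap (e n i \<tau>)})\<^sup>*"
    if "\<tau> \<in> used n" "i < 2 ^ n" for n i \<tau>
    using someI_ex[OF ex_sep[OF that]] by (simp_all add: sep_def e_def)
  \<comment> \<open>Both orientations are removed, so that \<open>E - B k\<close> stays
    symmetric.\<close>
  define B where "B = (\<lambda>(n, i). e n i ` used n \<union> (prod.swap \<circ> e n i) ` used n)"
  define S where "S k = {v. (x, v) \<in> (E - B k)\<^sup>*}" for k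
  have lists: "finite {\<tau> :: bool list. length \<tau> = n}" "card {\<tau> :: bool list. length \<tau> = n} = 2 ^ n" for n
    using finite_lists_length_eq[of "UNIV :: bool set" n] card_lists_length_eq[of "UNIV :: bool set" n]
    by simp_all
  have used: "finite (used n)" "card (used n) \<le> 2 ^ n" for n
  proof -
    have sub: "used n \<subseteq> {\<tau>. length \<tau> = n}" by (auto simp: used_def)
    show "finite (used n)" using finite_subset[OF sub lists(1)] .
    show "card (used n) \<le> 2 ^ n" using card_mono[OF lists(1) sub] lists(2) by simp
  qed
  have B_fin: "finite (B k)" for k using used by (cases k) (simp add: B_def)
  have B_card: "card (B (n, i)) \<le> 2 * 2 ^ n" for n i
  proof -
    have "card (B (n, i)) \<le> card (e n i ` used n) + card ((prod.swap \<circ> e n i) ` used n)"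
      unfolding B_def by (simp add: card_Un_le)
    also have "\<dots> \<le> card (used n) + card (used n)"
      by (intro add_mono card_image_le used)
    finally show ?thesis using used(2)[of n] by simp
  qed
  have B_lev: "a \<in> E \<and> min (lev (fst a)) (lev (snd a)) = N n + i" if "a \<in> B (n, i)" "i < 2 ^ n" for a n i
  proof -
    from that(1) obtain \<tau> where "\<tau> \<in> used n" and a: "a = e n i \<tau> \<or> a = prod.swap (e n i \<tau>)"
      by (auto simp: B_def)
    note e[OF this(1) that(2)]
    moreover from calculation have "prod.swap (e n i \<tau>) \<in> E"
      using symE by (cases "e n i \<tau>") (auto dest: symD)
    ultimately show ?thesis using a by auto
  qed
  have B_swap: "(v, u) \<in> B k" if "(u, v) \<in> B k" for u v k
  proof -
    obtain n i where k: "k = (n, i)" by (cases k)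
    from that obtain \<tau> where "\<tau> \<in> used n" and a: "(u, v) = e n i \<tau> \<or> (u, v) = prod.swap (e n i \<tau>)"
      by (auto simp: B_def k)
    moreover have "(v, u) = prod.swap (e n i \<tau>) \<or> (v, u) = e n i \<tau>"
      using a by (cases "e n i \<tau>") auto
    ultimately show ?thesis by (auto simp: B_def k)
  qed
  have S_x: "x \<in> S k" for k by (simp add: S_def)
  have S_cut: "(u, v) \<in> B k" if "(u, v) \<in> E" "u \<in> S k \<longleftrightarrow> v \<notin> S k" for u v k
  proof (rule ccontr)
    assume "(u, v) \<notin> B k"
    then have "(u, v) \<in> E - B k" "(v, u) \<in> E - B k" using that(1) symE B_swap[of v u k] by (auto dest: symD)
    then show False
      using that(2) rtrancl_into_rtrancl[of x u "E - B k" v] rtrancl_into_rtrancl[of x v "E - B k" u]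
      unfolding S_def by blast
  qed
  have S_V: "S k \<subseteq> pverts T" for k
  proof
    fix v assume "v \<in> S k"
    then have "(x, v) \<in> (E - B k)\<^sup>*" by (simp add: S_def)
    then show "v \<in> pverts T"
      by (induction rule: rtrancl_induct) (use x T.in_arcsD2 in \<open>auto simp: E_def\<close>)
  qed
  have cross: "\<exists>u v. (u, v) \<in> E \<and> u \<in> S k \<and> v \<in> S k \<and> \<not> P u \<and> P v" if "v \<in> S k" "\<not> P x" "P v" for k v P
  proof -
    have "(x, v) \<in> (E - B k)\<^sup>*" using that(1) by (simp add: S_def)
    then show ?thesis using that(2,3)
    proof (induction rule: rtrancl_induct)
      case (step u v)
      have "u \<in> S k" "v \<in> S k"
        using step(1) rtrancl_into_rtrancl[OF step(1,2)] by (simp_all add: S_def)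
      then show ?case using step by (cases "P u") auto
    qed simp
  qed
  have S_addr: "length (addr v) \<le> n" if "v \<in> S (n, i)" "length (addr x) < n" "i < 2 ^ n" for v n i
  proof (rule ccontr)
    assume "\<not> length (addr v) \<le> n"
    \<comment> \<open>The ancestor block of \<open>v\<close> in generation \<open>n\<close>.\<close>
    define \<tau> where "\<tau> = drop (length (addr v) - n) (addr v)"
    have \<tau>: "length \<tau> = n" "strict_suffix \<tau> (addr v)" "suffix \<tau> (addr v)"
      using \<open>\<not> length (addr v) \<le> n\<close> unfolding \<tau>_def
      by (auto simp: strict_suffix_def suffix_drop dest: arg_cong[where f = length])
    have nx: "\<not> suffix \<tau> (addr x)" "\<not> strict_suffix \<tau> (addr x)"
      using \<tau> that(2) by (auto simp: strict_suffix_def dest: suffix_length_le)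
    \<comment> \<open>The way from \<open>x\<close> to \<open>v\<close> inside the component enters
      below \<open>\<tau>\<close> through the entry and goes on through the exit. So both terminals
      lie in the component, although the deleted edge separates them.\<close>
    have "rt \<tau> \<in> S (n, i)"
      using cross[of v "(n, i)" "\<lambda>u. suffix \<tau> (addr u)"] that(1) nx(1) \<tau>(3) enter unfolding E_def by blast
    moreover have "lf \<tau> \<in> S (n, i)"
      using cross[of v "(n, i)" "\<lambda>u. strict_suffix \<tau> (addr u)"] that(1) nx(2) \<tau>(2) leave unfolding E_def by blast
    ultimately have "\<tau> \<in> used n" and r: "(x, rt \<tau>) \<in> (E - B (n, i))\<^sup>*" "(x, lf \<tau>) \<in> (E - B (n, i))\<^sup>*"
      using S_V \<tau>(1) by (auto simp: used_def S_def)
    have "sym (E - B (n, i))" using symE B_swap by (auto simp: sym_def)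
    then have "(rt \<tau>, x) \<in> (E - B (n, i))\<^sup>*" using r(1) by (meson sym_rtrancl symD)
    then have "(rt \<tau>, lf \<tau>) \<in> (E - B (n, i))\<^sup>*" using r(2) by (rule rtrancl_trans)
    moreover have "E - B (n, i) \<subseteq> E - {e n i \<tau>, prod.swap (e n i \<tau>)}"
      using \<open>\<tau> \<in> used n\<close> by (auto simp: B_def)
    ultimately show False using e(4)[OF \<open>\<tau> \<in> used n\<close> that(3)] rtrancl_mono by blast
  qed
  have S_fin: "finite (S (n, i))" if "length (addr x) < n" "i < 2 ^ n" for n i
    by (rule finite_subset[OF _ fin_levels[of n]]) (use S_addr[OF _ that] S_V[of "(n, i)"] in blast)
  \<comment> \<open>Generations occupy disjoint ranges of levels, so the lower level
    \<open>N n + i\<close> of an arc in a cutset determines \<open>n\<close> and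
    \<open>i\<close>.\<close>
  have N_mono: "N m + 2 ^ m < N n" if "m < n" for m n
    using that by (induction n) (auto simp: N_Suc less_Suc_eq)
  have B_disj: "B (n, i) \<inter> B (m, j) = {}" if "(n, i) \<noteq> (m, j)" "i < 2 ^ n" "j < 2 ^ m" for n i m j
  proof (rule ccontr)
    assume "B (n, i) \<inter> B (m, j) \<noteq> {}"
    then obtain a where "a \<in> B (n, i)" "a \<in> B (m, j)" by blast
    then have "N n + i = N m + j"
      using B_lev[of a n i] B_lev[of a m j] that by simp
    then show False using that N_mono[of m n] N_mono[of n m] by (cases m n rule: linorder_cases) auto
  qed
  have eq: "measure (srw T x) {\<omega>. \<exists>n\<ge>1. \<omega> n = x} = 1"
  proof (rule return_prob_eq_1)
    fix \<epsilon> :: real assume "\<epsilon> > 0"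
    define M where "M = nat \<lceil>2 / \<epsilon>\<rceil> + 1"
    have "2 / \<epsilon> \<le> real M" unfolding M_def by linarith
    moreover have "M > 0" by (simp add: M_def)
    ultimately have M: "2 / real M \<le> \<epsilon>" "M > 0"
      using \<open>\<epsilon> > 0\<close> by (auto simp: pos_divide_le_eq mult.commute)
    \<comment> \<open>\<open>M\<close> generations, all beyond that of \<open>x\<close>, as
      \<open>S_addr\<close> requires.\<close>
    define n\<^sub>0 where "n\<^sub>0 = Suc (length (addr x))"
    define K where "K = (SIGMA n:{n\<^sub>0..<n\<^sub>0 + M}. {..<2 ^ n :: nat})"
    \<comment> \<open>Total weight \<open>1 / M\<close> per generation, spread evenly over its
      \<open>2 ^ n\<close> cutsets. With at most \<open>2 * 2 ^ n\<close> arcs in each, a generation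
      adds at most \<open>2 / M\<^sup>2\<close> to the energy.\<close>
    define w :: "nat \<times> nat \<Rightarrow> real" where "w k = 1 / (M * 2 ^ fst k)" for k
    have "\<exists>f::'a \<Rightarrow> real. finite {v. f v \<noteq> 0} \<and> f x = 1 \<and> energy T f \<le> (\<Sum>k\<in>K. card (B k) * (w k)\<^sup>2)"
    proof (rule cutset_energy)
      show "finite (S k)" if "k \<in> K" for k
        using that by (cases k) (auto simp: K_def n\<^sub>0_def intro!: S_fin)
      show "B k \<subseteq> parcs T" if "k \<in> K" for k
        using that B_lev by (cases k) (auto simp: K_def E_def)
      show "B j \<inter> B k = {}" if "j \<in> K" "k \<in> K" "j \<noteq> k" for j k
        using that B_disj by (cases j; cases k) (simp add: K_def)
      have "sum w K = (\<Sum>n\<in>{n\<^sub>0..<n\<^sub>0 + M}. \<Sum>i<(2 ^ n :: nat). 1 / (M * 2 ^ n))"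
        unfolding K_def w_def by (subst sum.Sigma) (auto simp: case_prod_beta)
      also have "\<dots> = (\<Sum>n\<in>{n\<^sub>0..<n\<^sub>0 + M}. 1 / real M)"
        by (intro sum.cong) auto
      also have "\<dots> = 1" using M by simp
      finally show "sum w K = 1" .
    qed (use S_x B_fin S_cut in \<open>auto simp: K_def w_def E_def\<close>)
    then obtain f :: "'a \<Rightarrow> real" where
      f: "finite {v. f v \<noteq> 0}" "f x = 1" "energy T f \<le> (\<Sum>k\<in>K. card (B k) * (w k)\<^sup>2)"
      by blast
    have "(\<Sum>k\<in>K. card (B k) * (w k)\<^sup>2) \<le> 2 / real M"
    proof -
      have "(\<Sum>k\<in>K. card (B k) * (w k)\<^sup>2) \<le> (\<Sum>k\<in>K. (2 * 2 ^ fst k) * (w k)\<^sup>2)"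
      proof (intro sum_mono mult_right_mono)
        fix k show "real (card (B k)) \<le> 2 * 2 ^ fst k"
          using of_nat_mono[OF B_card[of "fst k" "snd k"], where 'a = real] by simp
      qed auto
      also have "\<dots> = (\<Sum>n\<in>{n\<^sub>0..<n\<^sub>0 + M}. \<Sum>i<(2 ^ n :: nat). (2 * 2 ^ n) * (1 / (M * 2 ^ n))\<^sup>2)"
        unfolding K_def w_def by (subst sum.Sigma) (auto simp: case_prod_beta)
      also have "\<dots> = (\<Sum>n\<in>{n\<^sub>0..<n\<^sub>0 + M}. 2 / (real M)\<^sup>2)"
        by (intro sum.cong) (auto simp: power2_eq_square field_simps)
      also have "\<dots> = 2 / real M" by (simp add: power2_eq_square)
      finally show ?thesis .
    qed
    then have "energy T f \<le> \<epsilon>" using f(3) M(1) by linarith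
    then show "\<exists>f. finite {v. f v \<noteq> 0} \<and> f x = 1 \<and> energy T f \<le> \<epsilon>"
      using f by blast
  qed
  show ?thesis
  proof
    assume "transient T"
    then have "measure (srw T x) {\<omega>. \<exists>n\<ge>1. \<omega> n = x} < 1"
      unfolding transient_def using x by (rule bspec)
    then show False unfolding eq by simp
  qed
qed

section \<open>Averages over boxes\<close>

text \<open>As \<open>1 / 2 \<le> (3 / 4)\<^sup>2\<close>, the increments are dominated by
  \<open>sqrt B * (3 / 4) ^ j\<close>, and the geometric series sums to at most 4.\<close>

lemma geometric_telescope:
  fixes a :: "nat \<Rightarrow> real"
  assumes "B \<ge> 0" and step: "\<And>j. j < n \<Longrightarrow> (a (Suc j) - a j)\<^sup>2 \<le> B * (1 / 2) ^ j"
  shows "(a n - a 0)\<^sup>2 \<le> 16 * B"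
proof -
  have "\<bar>a (Suc j) - a j\<bar> \<le> sqrt B * (3 / 4) ^ j" if "j < n" for j
  proof (rule power2_le_imp_le)
    have "\<bar>a (Suc j) - a j\<bar>\<^sup>2 \<le> B * (1 / 2) ^ j" using step[OF that] by simp
    also have "\<dots> \<le> B * ((3 / 4)\<^sup>2) ^ j" using \<open>B \<ge> 0\<close>
      by (intro mult_left_mono power_mono) (auto simp: power2_eq_square)
    also have "\<dots> = (sqrt B * (3 / 4) ^ j)\<^sup>2"
      using \<open>B \<ge> 0\<close> by (simp add: power_mult_distrib power_mult[symmetric] mult.commute)
    finally show "\<bar>a (Suc j) - a j\<bar>\<^sup>2 \<le> (sqrt B * (3 / 4) ^ j)\<^sup>2" .
  qed (use \<open>B \<ge> 0\<close> in auto)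
  then have "\<bar>a n - a 0\<bar> \<le> (\<Sum>j<n. sqrt B * (3 / 4) ^ j)"
    unfolding sum_lessThan_telescope[symmetric] by (intro order_trans[OF sum_abs] sum_mono) auto
  also have "\<dots> = sqrt B * (\<Sum>j<n. (3 / 4) ^ j)" by (simp add: sum_distrib_left)
  also have "(\<Sum>j<n. (3 / 4) ^ j) \<le> (4 :: real)"
    using sum_gp_strict[of "3 / 4 :: real" n] by simp
  finally have "\<bar>a n - a 0\<bar> \<le> sqrt B * 4" using \<open>B \<ge> 0\<close> by (simp add: mult_left_mono)
  then have "\<bar>a n - a 0\<bar>\<^sup>2 \<le> (sqrt B * 4)\<^sup>2" by (intro power_mono) auto
  then show ?thesis using \<open>B \<ge> 0\<close> by (simp add: power_mult_distrib)
qed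

text \<open>The averages differ by half the mean of \<open>g (p + m) - g p\<close>, and each such
  difference is a sum of \<open>m\<close> increments. Cauchy-Schwarz is applied to both sums; a
  factor \<open>1 / 4\<close> is given away.\<close>

lemma line_average_double:
  fixes g :: "nat \<Rightarrow> real"
  assumes "m > 0"
  shows "((\<Sum>p<2 * m. g p) / real (2 * m) - (\<Sum>p<m. g p) / m)\<^sup>2 \<le> m * (\<Sum>p<2 * m - 1. (g (Suc p) - g p)\<^sup>2)"
    (is "_ \<le> real m * ?D")
proof -
  have le: "(g (p + m) - g p)\<^sup>2 \<le> m * ?D" if "p < m" for p
  proof -
    have "g (p + m) - g p = (\<Sum>i<m. g (Suc (p + i)) - g (p + i))"
      using sum_lessThan_telescope[of "\<lambda>i. g (p + i)" m] by simp
    also have "\<dots>\<^sup>2 \<le> (\<Sum>i<m. (g (Suc (p + i)) - g (p + i))\<^sup>2) * card {..<m}"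
      by (rule sum_squared_le_sum_of_squares)
    also have "(\<Sum>i<m. (g (Suc (p + i)) - g (p + i))\<^sup>2) = (\<Sum>i\<in>(+) p ` {..<m}. (g (Suc i) - g i)\<^sup>2)"
      by (subst sum.reindex) auto
    also have "\<dots> * card {..<m} \<le> ?D * card {..<m}"
      using that by (intro mult_right_mono sum_mono2) auto
    finally show ?thesis by (simp add: mult.commute)
  qed
  have split: "(\<Sum>p<2 * m. g p) = (\<Sum>p<m. g p) + (\<Sum>p<m. g (p + m))"
    using sum.atLeastLessThan_concat[of 0 m "m + m" g] sum.shift_bounds_nat_ivl[of g 0 m m]
    by (simp add: lessThan_atLeast0 mult_2)
  have "(\<Sum>p<2 * m. g p) / real (2 * m) - (\<Sum>p<m. g p) / m = (\<Sum>p<m. g (p + m) - g p) / (2 * m)"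
    unfolding split sum_subtractf using assms by (simp add: field_simps)
  then have "((\<Sum>p<2 * m. g p) / real (2 * m) - (\<Sum>p<m. g p) / m)\<^sup>2 = ((\<Sum>p<m. g (p + m) - g p) / (2 * m))\<^sup>2"
    by (simp only:)
  also have "\<dots> = (\<Sum>p<m. g (p + m) - g p)\<^sup>2 / (4 * m\<^sup>2)" by (simp add: power_divide power_mult_distrib)
  also have "\<dots> \<le> ((\<Sum>p<m. (g (p + m) - g p)\<^sup>2) * m) / (4 * m\<^sup>2)"
    using sum_squared_le_sum_of_squares[of "\<lambda>p. g (p + m) - g p" "{..<m}"] by (intro divide_right_mono) auto
  also have "\<dots> \<le> ((\<Sum>p<m. m * ?D) * m) / (4 * m\<^sup>2)"
    using le by (intro divide_right_mono mult_right_mono sum_mono) auto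
  also have "\<dots> = m * ?D / 4" using assms by (simp add: power2_eq_square)
  also have "\<dots> \<le> m * ?D" by (simp add: sum_nonneg)
  finally show ?thesis .
qed

definition mean :: "nat \<Rightarrow> nat \<Rightarrow> nat \<Rightarrow> (nat \<Rightarrow> nat \<Rightarrow> nat \<Rightarrow> real) \<Rightarrow> real" where
  "mean a b c g = (\<Sum>p<a. \<Sum>q<b. \<Sum>r<c. g p q r) / (a * b * c)"

lemma double_sum_squared_le:
  fixes X :: "nat \<Rightarrow> nat \<Rightarrow> real"
  shows "(\<Sum>q<b. \<Sum>r<c. X q r)\<^sup>2 \<le> b * c * (\<Sum>q<b. \<Sum>r<c. (X q r)\<^sup>2)"
  using sum_squared_le_sum_of_squares[of "\<lambda>(q, r). X q r" "{..<b} \<times> {..<c}"]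
  by (simp add: sum.cartesian_product case_prod_beta mult.commute)

lemma mean_squared_le:
  "(mean a b c g)\<^sup>2 \<le> (\<Sum>p<a. \<Sum>q<b. \<Sum>r<c. (g p q r)\<^sup>2) / (a * b * c)"
proof (cases "a = 0 \<or> b = 0 \<or> c = 0")
  case True
  then show ?thesis by (auto simp: mean_def)
next
  case False
  have "(\<Sum>p<a. \<Sum>q<b. \<Sum>r<c. g p q r)\<^sup>2 \<le> (a * b * c) * (\<Sum>p<a. \<Sum>q<b. \<Sum>r<c. (g p q r)\<^sup>2)"
    using sum_squared_le_sum_of_squares[of "\<lambda>(p, q, r). g p q r" "{..<a} \<times> {..<b} \<times> {..<c}"]
    by (simp add: sum.cartesian_product case_prod_beta mult.commute mult.left_commute)
  then show ?thesis using False
    by (simp add: mean_def power_divide field_simps power2_eq_square)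
qed

lemma mean_swap: "mean a b c g = mean b a c (\<lambda>q p r. g p q r)"
  unfolding mean_def by (subst sum.swap) (simp add: mult.commute)

lemma mean_swap': "mean a b c g = mean a c b (\<lambda>p r q. g p q r)"
  unfolding mean_def by (subst (2) sum.swap) (simp add: mult.commute mult.left_commute)

text \<open>\<open>line_average_double\<close> on each line, then Cauchy-Schwarz across the lines.
  If \<open>b\<close> and \<open>c\<close> are at least \<open>m\<close>, the factor is at most
  \<open>1 / m\<close>, which decays geometrically for \<open>m = 2 ^ j\<close>: this is where
  dimension three enters.\<close>

lemma mean_double:
  assumes "m > 0" "b > 0" "c > 0"
  shows "(mean (2 * m) b c g - mean m b c g)\<^sup>2
    \<le> m / (b * c) * (\<Sum>p<2 * m - 1. \<Sum>q<b. \<Sum>r<c. (g (Suc p) q r - g p q r)\<^sup>2)"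
proof -
  define X where "X q r = (\<Sum>p<2 * m. g p q r) / real (2 * m) - (\<Sum>p<m. g p q r) / m" for q r
  have eq: "mean n b c g = (\<Sum>q<b. \<Sum>r<c. (\<Sum>p<n. g p q r) / n) / (b * c)" for n
  proof -
    have "(\<Sum>p<n. \<Sum>q<b. \<Sum>r<c. g p q r) = (\<Sum>q<b. \<Sum>r<c. \<Sum>p<n. g p q r)"
      by (subst sum.swap) (intro sum.cong refl sum.swap)
    then show ?thesis by (simp add: mean_def sum_divide_distrib mult.assoc)
  qed
  have "(mean (2 * m) b c g - mean m b c g)\<^sup>2 = (\<Sum>q<b. \<Sum>r<c. X q r)\<^sup>2 / (b * c)\<^sup>2"
    unfolding eq X_def diff_divide_distrib[symmetric] sum_subtractf[symmetric]
    by (simp add: power_divide)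
  also have "\<dots> \<le> (b * c * (\<Sum>q<b. \<Sum>r<c. (X q r)\<^sup>2)) / (b * c)\<^sup>2"
    using double_sum_squared_le by (intro divide_right_mono) auto
  also have "\<dots> = (\<Sum>q<b. \<Sum>r<c. (X q r)\<^sup>2) / (b * c)"
    using assms by (simp add: power2_eq_square)
  also have "\<dots> \<le> (\<Sum>q<b. \<Sum>r<c. m * (\<Sum>p<2 * m - 1. (g (Suc p) q r - g p q r)\<^sup>2)) / (b * c)"
    unfolding X_def by (intro divide_right_mono sum_mono line_average_double assms) auto
  also have "(\<Sum>q<b. \<Sum>r<c. m * (\<Sum>p<2 * m - 1. (g (Suc p) q r - g p q r)\<^sup>2))
      = m * (\<Sum>p<2 * m - 1. \<Sum>q<b. \<Sum>r<c. (g (Suc p) q r - g p q r)\<^sup>2)"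
  proof -
    have "(\<Sum>p<2 * m - 1. \<Sum>q<b. \<Sum>r<c. (g (Suc p) q r - g p q r)\<^sup>2)
        = (\<Sum>q<b. \<Sum>r<c. \<Sum>p<2 * m - 1. (g (Suc p) q r - g p q r)\<^sup>2)"
      by (subst sum.swap) (intro sum.cong refl sum.swap)
    then show ?thesis by (simp add: sum_distrib_left)
  qed
  finally show ?thesis by simp
qed

lemma sum_div2: "(\<Sum>p<2 * m. g (p div 2)) = 2 * (\<Sum>p<m. g p)" for g :: "nat \<Rightarrow> real"
  by (induction m) (auto simp: algebra_simps)

text \<open>Halving is eight-to-one, so averaging the values at the parents weights all parents
  equally.\<close>

lemma mean_div2: "mean (2 * a) (2 * b) (2 * c) (\<lambda>p q r. g (p div 2) (q div 2) (r div 2)) = mean a b c g"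
proof -
  have "(\<Sum>p<2 * a. \<Sum>q<2 * b. \<Sum>r<2 * c. g (p div 2) (q div 2) (r div 2))
      = (\<Sum>p<2 * a. \<Sum>q<2 * b. 2 * (\<Sum>r<c. g (p div 2) (q div 2) r))"
    by (simp add: sum_div2)
  also have "\<dots> = (\<Sum>p<2 * a. 2 * (\<Sum>q<b. 2 * (\<Sum>r<c. g (p div 2) q r)))"
    by (intro sum.cong refl sum_div2[of "\<lambda>q. 2 * (\<Sum>r<c. g (_ div 2) q r)"])
  also have "\<dots> = 2 * (\<Sum>p<a. 2 * (\<Sum>q<b. 2 * (\<Sum>r<c. g p q r)))"
    by (rule sum_div2[of "\<lambda>p. 2 * (\<Sum>q<b. 2 * (\<Sum>r<c. g p q r))"])
  finally show ?thesis by (simp add: mean_def sum_distrib_left[symmetric])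
qed

text \<open>
  The values at the two terminals are compared through the averages over the levels \<open>0, \<dots>, L\<close>, and
  then through the averages over the corner cubes of side \<open>2\<^sup>L, \<dots>, 2, 1\<close> in level \<open>L\<close>.
\<close>

lemma box_average_bound:
  fixes F :: "nat \<Rightarrow> nat \<Rightarrow> nat \<Rightarrow> nat \<Rightarrow> real"
  assumes vert: "\<And>k. k < L \<Longrightarrow>
      (\<Sum>p<2 ^ Suc k. \<Sum>q<2 ^ Suc k. \<Sum>r<2 ^ Suc k. (F (Suc k) p q r - F k (p div 2) (q div 2) (r div 2))\<^sup>2) \<le> D"
    and hor1: "(\<Sum>p<2 ^ L - 1. \<Sum>q<2 ^ L. \<Sum>r<2 ^ L. (F L (Suc p) q r - F L p q r)\<^sup>2) \<le> D"
    and hor2: "(\<Sum>p<2 ^ L. \<Sum>q<2 ^ L - 1. \<Sum>r<2 ^ L. (F L p (Suc q) r - F L p q r)\<^sup>2) \<le> D"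
    and hor3: "(\<Sum>p<2 ^ L. \<Sum>q<2 ^ L. \<Sum>r<2 ^ L - 1. (F L p q (Suc r) - F L p q r)\<^sup>2) \<le> D"
  shows "(F 0 0 0 0 - F L 0 0 0)\<^sup>2 \<le> 320 * D"
proof -
  have "0 \<le> (\<Sum>p<2 ^ L - 1. \<Sum>q<2 ^ L. \<Sum>r<2 ^ L. (F L (Suc p) q r - F L p q r)\<^sup>2)"
    by (intro sum_nonneg) auto
  with hor1 have D: "D \<ge> 0" by linarith
  define A where "A k = mean (2 ^ k) (2 ^ k) (2 ^ k) (F k)" for k
  define B where "B j = mean (2 ^ j) (2 ^ j) (2 ^ j) (F L)" for j
  have "(A L - A 0)\<^sup>2 \<le> 16 * D"
  proof (rule geometric_telescope[OF D])
    fix k assume k: "k < L"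
    let ?n = "2 ^ Suc k :: nat"
    have eq: "A (Suc k) - A k = mean ?n ?n ?n (\<lambda>p q r. F (Suc k) p q r - F k (p div 2) (q div 2) (r div 2))"
      using mean_div2[of "2 ^ k" "2 ^ k" "2 ^ k" "F k"]
      by (simp add: A_def mean_def sum_subtractf diff_divide_distrib)
    have "(A (Suc k) - A k)\<^sup>2
        \<le> (\<Sum>p<?n. \<Sum>q<?n. \<Sum>r<?n. (F (Suc k) p q r - F k (p div 2) (q div 2) (r div 2))\<^sup>2) / (?n * ?n * ?n)"
      unfolding eq by (rule mean_squared_le)
    also have "\<dots> \<le> D / (?n * ?n * ?n)" by (rule divide_right_mono[OF vert[OF k] of_nat_0_le_iff])
    \<comment> \<open>The rate \<open>8 ^ Suc k\<close> is weakened to the one that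
      \<open>geometric_telescope\<close> takes.\<close>
    also have "\<dots> \<le> D / 2 ^ k"
    proof (rule divide_left_mono[OF _ D])
      have "(1 :: real) \<le> 2 * 2 ^ k" using one_le_power[of "2 :: real" "Suc k"] by simp
      then have "2 ^ k * (1 * 1) \<le> 2 * 2 ^ k * ((2 * 2 ^ k) * (2 * 2 ^ k) :: real)"
        by (intro mult_mono) auto
      then show "2 ^ k \<le> real (?n * ?n * ?n)" by (simp add: mult.assoc)
    qed simp
    finally show "(A (Suc k) - A k)\<^sup>2 \<le> D * (1 / 2) ^ k" by (simp add: power_one_over field_simps)
  qed
  \<comment> \<open>The sides are doubled one coordinate at a time, each at cost
    \<open>D / m\<close>; the square of a sum of three terms brings another factor 3.\<close>
  moreover have "(B L - B 0)\<^sup>2 \<le> 16 * (9 * D)"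
  proof (rule geometric_telescope)
    fix j assume j: "j < L"
    define m :: nat where "m = 2 ^ j"
    have m: "m > 0" by (simp add: m_def)
    have n: "2 * m \<le> 2 ^ L" using power_increasing[of "Suc j" L "2 :: nat"] j by (simp add: m_def)
    have sub: "(\<Sum>p<a. \<Sum>q<b. \<Sum>r<c. (X p q r)\<^sup>2) \<le> (\<Sum>p<a'. \<Sum>q<b'. \<Sum>r<c'. (X p q r)\<^sup>2)"
      if "a \<le> a'" "b \<le> b'" "c \<le> c'" for a b c a' b' c' :: nat and X :: "nat \<Rightarrow> nat \<Rightarrow> nat \<Rightarrow> real"
      unfolding sum.cartesian_product using that by (intro sum_mono2) auto
    have bound: "real m / (real b * real c) * X \<le> D / m" if "m \<le> b" "m \<le> c" "X \<le> D" "0 \<le> X" for b c :: nat and X :: real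
    proof -
      have "real m / (real b * real c) * X \<le> real m / (real m * real m) * D"
      proof (rule mult_mono)
        have "real m * real m \<le> real b * real c" using that by (intro mult_mono) auto
        then show "real m / (real b * real c) \<le> real m / (real m * real m)"
          using m that by (intro divide_left_mono) auto
      qed (use that in auto)
      also have "\<dots> = D / m" using m by simp
      finally show ?thesis .
    qed
    let ?n = "2 * m"
    have nonneg: "0 \<le> (\<Sum>p<a. \<Sum>q<b. \<Sum>r<c. (X p q r)\<^sup>2)" for a b c :: nat and X :: "nat \<Rightarrow> nat \<Rightarrow> nat \<Rightarrow> real"
      by (intro sum_nonneg) auto
    have 1: "(mean ?n ?n ?n (F L) - mean m ?n ?n (F L))\<^sup>2 \<le> D / m"
    proof (rule order_trans[OF mean_double bound])
      show "(\<Sum>p<?n - 1. \<Sum>q<?n. \<Sum>r<?n. (F L (Suc p) q r - F L p q r)\<^sup>2) \<le> D"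
        using n by (intro order_trans[OF sub hor1]) auto
    qed (use m nonneg in auto)
    have 2: "(mean m ?n ?n (F L) - mean m m ?n (F L))\<^sup>2 \<le> D / m"
      unfolding mean_swap[of m ?n] mean_swap[of m m _ "F L"]
    proof (rule order_trans[OF mean_double bound])
      have "(\<Sum>p<m. \<Sum>q<?n - 1. \<Sum>r<?n. (F L p (Suc q) r - F L p q r)\<^sup>2) \<le> D"
        using n by (intro order_trans[OF sub hor2]) auto
      then show "(\<Sum>q<?n - 1. \<Sum>p<m. \<Sum>r<?n. (F L p (Suc q) r - F L p q r)\<^sup>2) \<le> D"
        by (subst sum.swap)
    qed (use m nonneg in auto)
    have rotate: "mean m m c (F L) = mean c m m (\<lambda>r p q. F L p q r)" for c
      by (subst mean_swap', subst mean_swap) (rule refl)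
    have 3: "(mean m m ?n (F L) - mean m m m (F L))\<^sup>2 \<le> D / m"
      unfolding rotate[of ?n] rotate[of m]
    proof (rule order_trans[OF mean_double bound])
      have "(\<Sum>p<m. \<Sum>q<m. \<Sum>r<?n - 1. (F L p q (Suc r) - F L p q r)\<^sup>2) \<le> D"
        using n by (intro order_trans[OF sub hor3]) auto
      also have "(\<Sum>p<m. \<Sum>q<m. \<Sum>r<?n - 1. (F L p q (Suc r) - F L p q r)\<^sup>2)
         = (\<Sum>p<m. \<Sum>r<?n - 1. \<Sum>q<m. (F L p q (Suc r) - F L p q r)\<^sup>2)"
        by (intro sum.cong refl sum.swap)
      finally show "(\<Sum>r<?n - 1. \<Sum>p<m. \<Sum>q<m. (F L p q (Suc r) - F L p q r)\<^sup>2) \<le> D"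
        by (subst sum.swap)
    qed (use m nonneg in auto)
    have sq: "(x + y + z)\<^sup>2 \<le> 3 * (x\<^sup>2 + y\<^sup>2 + z\<^sup>2)" for x y z :: real
      using sum_squares_ge_zero[of "x - y" "y - z"] zero_le_power2[of "x - z"]
      by (simp add: power2_eq_square algebra_simps)
    have eq: "B (Suc j) - B j = (mean ?n ?n ?n (F L) - mean m ?n ?n (F L))
        + (mean m ?n ?n (F L) - mean m m ?n (F L)) + (mean m m ?n (F L) - mean m m m (F L))"
      by (simp add: B_def m_def)
    have "(B (Suc j) - B j)\<^sup>2 \<le> 3 * (D / m + D / m + D / m)"
      unfolding eq by (rule order_trans[OF sq]) (use 1 2 3 in auto)
    also have "\<dots> = 9 * D * (1 / 2) ^ j" by (simp add: m_def power_one_over field_simps)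
    finally show "(B (Suc j) - B j)\<^sup>2 \<le> 9 * D * (1 / 2) ^ j" .
  qed (use D in auto)
  moreover have "A 0 = F 0 0 0 0" "B 0 = F L 0 0 0" "A L = B L"
    by (simp_all add: A_def B_def mean_def)
  \<comment> \<open>The two chains meet in the average over the bottom level, which gives
    \<open>320 = 2 * (16 + 144)\<close>.\<close>
  moreover have "(x - z)\<^sup>2 \<le> 2 * ((y - x)\<^sup>2 + (y - z)\<^sup>2)" for x y z :: real
    using zero_le_power2[of "2 * y - x - z"] by (simp add: power2_eq_square algebra_simps)
  from this[of "A 0" "B 0" "A L"] have "(A 0 - B 0)\<^sup>2 \<le> 2 * ((A L - A 0)\<^sup>2 + (A L - B 0)\<^sup>2)" .
  ultimately show ?thesis by simp
qed

section \<open>The graph\<close>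

text \<open>
  \<open>(\<sigma>, k, p, q, r)\<close> is the grid point \<open>(p, q, r)\<close> on level \<open>k\<close> of the block with address \<open>\<sigma>\<close>.  The two
  blocks hanging off the exit of block \<open>\<sigma>\<close> have the addresses \<open>b # \<sigma>\<close>.
\<close>

type_synonym vertex = "bool list \<times> nat \<times> nat \<times> nat \<times> nat"

text \<open>The level of the entries of generation \<open>n\<close>: a block is \<open>2 ^ n\<close>
  levels deep, and one more edge leads from its exit to the next entries.\<close>

primrec offset :: "nat \<Rightarrow> nat" where
  "offset 0 = 0"
| "offset (Suc n) = offset n + 2 ^ n + 1"

definition boxes :: "vertex set" where
  "boxes = {(\<sigma>, k, p, q, r). k \<le> 2 ^ length \<sigma> \<and> p < 2 ^ k \<and> q < 2 ^ k \<and> r < 2 ^ k}"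

fun level :: "vertex \<Rightarrow> nat" where
  "level (\<sigma>, k, p, q, r) = offset (length \<sigma>) + k"

fun parent :: "vertex \<Rightarrow> vertex" where
  "parent (\<sigma>, Suc k, p, q, r) = (\<sigma>, k, p div 2, q div 2, r div 2)"
| "parent (b # \<sigma>, 0, p, q, r) = (\<sigma>, 2 ^ length \<sigma>, 0, 0, 0)"
| "parent ([], 0, p, q, r) = ([], 0, 0, 0, 0)"

text \<open>Sup-norm distance at most one. Diagonals are included because two steps in different
  coordinates can project to a diagonal one, which \<open>R_par2\<close> must allow.\<close>

fun beside :: "vertex \<Rightarrow> vertex \<Rightarrow> bool" where
  "beside (\<sigma>, k, p, q, r) (\<sigma>', k', p', q', r') \<longleftrightarrow> \<sigma> = \<sigma>' \<and> k = k' \<and>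
     p \<le> Suc p' \<and> p' \<le> Suc p \<and> q \<le> Suc q' \<and> q' \<le> Suc q \<and> r \<le> Suc r' \<and> r' \<le> Suc r"

lemma offset_eq_0: "offset n = 0 \<longleftrightarrow> n = 0"
  by (cases n) auto

interpretation boxes: augmented_tree boxes "([], 0, 0, 0, 0)" level parent beside
proof
  show "parent v \<in> boxes" if "v \<in> boxes" for v
    using that by (cases v rule: parent.cases) (auto simp: boxes_def)
  show "level (parent v) = level v - 1" if "v \<in> boxes" for v
    using that by (cases v rule: parent.cases) auto
  show "level v = 0 \<longleftrightarrow> v = ([], 0, 0, 0, 0)" if "v \<in> boxes" for v
    using that by (cases v) (auto simp: boxes_def offset_eq_0)
  show "beside (parent u) (parent w)"
    if uvw: "u \<in> boxes" "v \<in> boxes" "w \<in> boxes" "beside u v" "beside v w" for u v w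
  proof -
    obtain \<sigma> k p q r where u: "u = (\<sigma>, k, p, q, r)" by (cases u)
    obtain p' q' r' where v: "v = (\<sigma>, k, p', q', r')" using uvw(4) u by (cases v) auto
    obtain p'' q'' r'' where w: "w = (\<sigma>, k, p'', q'', r'')" using uvw(5) v by (cases w) auto
    \<comment> \<open>The contraction, one coordinate at a time: a difference of at most 2 becomes
      at most 1.\<close>
    have half: "i div 2 \<le> Suc (j div 2)" if "i \<le> Suc (Suc j)" for i j :: nat using that by arith
    show ?thesis
    proof (cases k)
      case 0
      then have "u = w" using uvw u w by (simp add: boxes_def)
      then show ?thesis by (cases "parent w") auto
    next
      case (Suc k')
      have "i \<le> Suc (Suc j)" if "i \<le> Suc m" "m \<le> Suc j" for i j m :: nat using that by arith
      note two = this
      show ?thesis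
        using uvw(4,5) unfolding u v w Suc by (auto intro!: half elim: two)
    qed
  qed
qed (auto simp: boxes_def)

section \<open>Adjacency, degrees and the tree of blocks\<close>

abbreviation adj :: "(vertex \<times> vertex) set" where
  "adj \<equiv> boxes.E"

lemma adj_cases [consumes 1, case_names beside child parent]:
  assumes "(u, v) \<in> adj"
  obtains "u \<in> boxes" "v \<in> boxes" "beside u v" | "u \<in> boxes" "v \<in> boxes" "u = parent v" "u \<noteq> v"
    | "u \<in> boxes" "v \<in> boxes" "v = parent u" "u \<noteq> v"
  using assms unfolding boxes.E_def by auto

lemma adj_besideI: "u \<in> boxes \<Longrightarrow> v \<in> boxes \<Longrightarrow> beside u v \<Longrightarrow> u \<noteq> v \<Longrightarrow> (u, v) \<in> adj"
  by (simp add: boxes.E_def)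

lemma adj_parentI: "u \<in> boxes \<Longrightarrow> v = parent u \<Longrightarrow> u \<noteq> v \<Longrightarrow> (u, v) \<in> adj"
  by (simp add: boxes.E_def boxes.par_V)

text \<open>Codes for all possible neighbours: \<open>t\<close> selects the same level (with shifts
  by -1, 0, 1), children in the block, entries of the two child blocks, or the parent. The
  \<open>4 * 3 * 3 * 3 = 108\<close> codes used below bound the degree; repetitions and values
  outside \<open>boxes\<close> do no harm.\<close>

fun neighbour :: "vertex \<Rightarrow> nat \<times> nat \<times> nat \<times> nat \<Rightarrow> vertex" where
  "neighbour (\<sigma>, k, p, q, r) (t, a, b, c) =
    (if t = 0 then (\<sigma>, k, p + a - 1, q + b - 1, r + c - 1)
     else if t = 1 then (\<sigma>, Suc k, 2 * p + a, 2 * q + b, 2 * r + c)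
     else if t = 2 then ((a = 0) # \<sigma>, 0, 0, 0, 0)
     else parent (\<sigma>, k, p, q, r))"

lemma adj_subset_neighbour: "adj `` {u} \<subseteq> neighbour u ` ({..3} \<times> {..2} \<times> {..2} \<times> {..2})"
proof
  fix v assume "v \<in> adj `` {u}"
  then have uv: "(u, v) \<in> adj" by simp
  obtain \<sigma> k p q r where u: "u = (\<sigma>, k, p, q, r)" by (cases u)
  obtain \<sigma>' k' p' q' r' where v: "v = (\<sigma>', k', p', q', r')" by (cases v)
  have "\<exists>t\<le>3. \<exists>a\<le>2. \<exists>b\<le>2. \<exists>c\<le>2. v = neighbour u (t, a, b, c)"
    using uv
  proof (cases rule: adj_cases)
    case beside
    then show ?thesis unfolding u v
      by (intro exI[of _ 0] conjI exI[of _ "p' + 1 - p"] exI[of _ "q' + 1 - q"] exI[of _ "r' + 1 - r"]) auto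
  next
    case child
    show ?thesis
    proof (cases k')
      case 0
      then obtain b where "\<sigma>' = b # \<sigma>" using child u v by (cases \<sigma>') (auto simp: boxes_def)
      then show ?thesis using child 0 unfolding u v
        by (intro exI[of _ 2] conjI exI[of _ "if b then 0 else 1"] exI[of _ 0]) (auto simp: boxes_def)
    next
      case (Suc j)
      then show ?thesis using child unfolding u v
        by (intro exI[of _ 1] conjI exI[of _ "p' mod 2"] exI[of _ "q' mod 2"] exI[of _ "r' mod 2"]) auto
    qed
  next
    case parent
    then show ?thesis unfolding u by (intro exI[of _ 3] conjI exI[of _ 0]) auto
  qed
  then show "v \<in> neighbour u ` ({..3} \<times> {..2} \<times> {..2} \<times> {..2})" by force
qed

lemma finite_adj: "finite (adj `` {u})"
  by (rule finite_subset[OF adj_subset_neighbour]) auto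

lemma card_adj_le: "card (adj `` {u}) \<le> 108"
proof -
  have "card (adj `` {u}) \<le> card (neighbour u ` ({..3} \<times> {..2} \<times> {..2} \<times> {..2}))"
    by (rule card_mono[OF _ adj_subset_neighbour]) auto
  also have "\<dots> \<le> card ({..3::nat} \<times> {..2::nat} \<times> {..2::nat} \<times> {..2::nat})"
    by (rule card_image_le) auto
  also have "\<dots> = 108" by (simp add: card_cartesian_product)
  finally show ?thesis .
qed

text \<open>An address grows at its head, so \<open>\<tau>\<close> is a suffix exactly of the
  addresses of the blocks at or below \<open>\<tau>\<close>. An arc changes the address only between
  an entry and its parent.\<close>

lemma adj_enter:
  assumes "(u, v) \<in> adj" "\<not> suffix \<tau> (fst u)" "suffix \<tau> (fst v)"
  shows "v = (\<tau>, 0, 0, 0, 0)"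
  using assms
proof (cases rule: adj_cases)
  case beside
  then show ?thesis using assms by (cases u; cases v) auto
next
  case child
  then show ?thesis using assms
    by (cases v rule: parent.cases) (auto simp: suffix_Cons boxes_def)
next
  case parent
  then show ?thesis using assms
    by (cases u rule: parent.cases) (auto simp: suffix_Cons)
qed

text \<open>The child blocks of \<open>\<tau>\<close> hang off its exit alone.\<close>

lemma adj_leave:
  assumes "(u, v) \<in> adj" "\<not> strict_suffix \<tau> (fst u)" "strict_suffix \<tau> (fst v)"
  shows "u = (\<tau>, 2 ^ length \<tau>, 0, 0, 0)"
  using assms
proof (cases rule: adj_cases)
  case beside
  then show ?thesis using assms by (cases u; cases v) auto
next
  case child
  then show ?thesis using assms
    by (cases v rule: parent.cases) (auto simp: strict_suffix_def suffix_Cons)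
next
  case parent
  then show ?thesis using assms
    by (cases u rule: parent.cases) (auto simp: strict_suffix_def suffix_Cons dest: suffix_length_le)
qed

lemma adj_level:
  assumes "(u, v) \<in> adj"
  shows "level v \<le> Suc (level u)"
  using assms
proof (cases rule: adj_cases)
  case beside
  then show ?thesis using boxes.R_lev[of u v] by simp
next
  case child
  then show ?thesis using boxes.lev_par[of v] by simp
next
  case parent
  then show ?thesis using boxes.lev_par[of u] by simp
qed

lemma finite_boxes: "finite {v \<in> boxes. length (fst v) \<le> n}"
proof (rule finite_subset)
  let ?L = "{\<sigma> :: bool list. length \<sigma> \<le> n}"
  show "{v \<in> boxes. length (fst v) \<le> n} \<subseteq> ?L \<times> {..2 ^ n} \<times> {..<2 ^ 2 ^ n} \<times> {..<2 ^ 2 ^ n} \<times> {..<2 ^ 2 ^ n}"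
  proof
    fix v assume v: "v \<in> {v \<in> boxes. length (fst v) \<le> n}"
    obtain \<sigma> k p q r where vv: "v = (\<sigma>, k, p, q, r)" by (cases v)
    have "length \<sigma> \<le> n" "k \<le> 2 ^ length \<sigma>" "p < 2 ^ k" "q < 2 ^ k" "r < 2 ^ k"
      using v by (auto simp: vv boxes_def)
    moreover have "k \<le> 2 ^ n"
      using calculation(1,2) power_increasing[of "length \<sigma>" n "2 :: nat"] by linarith
    moreover from this have "(2::nat) ^ k \<le> 2 ^ 2 ^ n"
      by (intro power_increasing) auto
    moreover from this have "p < 2 ^ 2 ^ n" "q < 2 ^ 2 ^ n" "r < 2 ^ 2 ^ n"
      using calculation(3-5) by (meson order_less_le_trans)+
    ultimately show "v \<in> ?L \<times> {..2 ^ n} \<times> {..<2 ^ 2 ^ n} \<times> {..<2 ^ 2 ^ n} \<times> {..<2 ^ 2 ^ n}"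
      unfolding vv by auto
  qed
  have "finite ?L" using finite_lists_length_le[of "UNIV :: bool set" n] by simp
  then show "finite (?L \<times> {..(2::nat) ^ n} \<times> {..<(2::nat) ^ 2 ^ n} \<times> {..<(2::nat) ^ 2 ^ n} \<times> {..<(2::nat) ^ 2 ^ n})"
    by (intro finite_cartesian_product) auto
qed

section \<open>The graph on the natural numbers\<close>

definition gadget_graph :: "nat pair_pre_digraph" where
  "gadget_graph = \<lparr>pverts = to_nat ` boxes, parcs = map_prod to_nat to_nat ` adj\<rparr>"

lemma pverts_gadget_graph: "pverts gadget_graph = to_nat ` boxes"
  and parcs_gadget_graph: "parcs gadget_graph = map_prod to_nat to_nat ` adj"
  by (simp_all add: gadget_graph_def)

lemma parcs_gadget_graphE:
  assumes "(x, y) \<in> parcs gadget_graph"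
  obtains u v where "x = to_nat u" "y = to_nat v" "(u, v) \<in> adj"
  using assms by (auto simp: parcs_gadget_graph)

lemma parcs_gadget_graph_iff [simp]: "(to_nat u, to_nat v) \<in> parcs gadget_graph \<longleftrightarrow> (u, v) \<in> adj"
  by (auto simp: parcs_gadget_graph)

lemma pair_bidirected_gadget_graph: "pair_bidirected_digraph gadget_graph"
proof
  show "fst e \<in> pverts gadget_graph" "snd e \<in> pverts gadget_graph" if "e \<in> parcs gadget_graph" for e
    using that by (auto simp: parcs_gadget_graph pverts_gadget_graph boxes.E_def)
  show "fst e \<noteq> snd e" if "e \<in> parcs gadget_graph" for e
    using that by (auto simp: parcs_gadget_graph boxes.E_def)
  show "symmetric (with_proj gadget_graph)"
    unfolding symmetric_def by (auto simp: sym_def parcs_gadget_graph dest: symD[OF boxes.sym_E])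
qed

lemma relpow_gadget_graph: "(to_nat u, to_nat v) \<in> parcs gadget_graph ^^ n \<longleftrightarrow> (u, v) \<in> adj ^^ n"
proof (induction n arbitrary: v)
  case (Suc n)
  show ?case
  proof
    assume "(to_nat u, to_nat v) \<in> parcs gadget_graph ^^ Suc n"
    then obtain y where y: "(to_nat u, y) \<in> parcs gadget_graph ^^ n" "(y, to_nat v) \<in> parcs gadget_graph"
      by auto
    from y(2) obtain w where "y = to_nat w" "(w, v) \<in> adj" by (auto elim!: parcs_gadget_graphE)
    then show "(u, v) \<in> adj ^^ Suc n" using y(1) Suc by auto
  next
    assume "(u, v) \<in> adj ^^ Suc n"
    then obtain w where "(u, w) \<in> adj ^^ n" "(w, v) \<in> adj" by auto
    then have "(to_nat u, to_nat w) \<in> parcs gadget_graph ^^ n" "(to_nat w, to_nat v) \<in> parcs gadget_graph"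
      using Suc by simp_all
    then show "(to_nat u, to_nat v) \<in> parcs gadget_graph ^^ Suc n" by auto
  qed
qed auto

lemma connected_gadget_graph: "Digraph_Component.connected (with_proj gadget_graph)"
proof -
  interpret pair_bidirected_digraph gadget_graph by (rule pair_bidirected_gadget_graph)
  have "pair_sym_digraph gadget_graph" by unfold_locales
  then show ?thesis
    using boxes.root_V boxes.dist_E_walk relpow_gadget_graph
    by (subst connected_with_proj_iff) (auto simp: pverts_gadget_graph intro!: relpow_imp_rtrancl)
qed

section \<open>Distances, hyperbolicity and bounded degree\<close>

lemma walk_iff_relpow:
  assumes "u \<in> pverts G"
  shows "(\<exists>p. pre_digraph.awalk (with_proj G) u p v \<and> length p = n) \<longleftrightarrow> (u, v) \<in> parcs G ^^ n"
proof -
  have "(\<exists>p. set p \<subseteq> parcs G \<and> pcas u p v \<and> length p = n) \<longleftrightarrow> (u, v) \<in> parcs G ^^ n"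
  proof (induction n arbitrary: u)
    case (Suc n)
    have "(\<exists>p. set p \<subseteq> parcs G \<and> pcas u p v \<and> length p = Suc n) \<longleftrightarrow>
        (\<exists>w p. (u, w) \<in> parcs G \<and> set p \<subseteq> parcs G \<and> pcas w p v \<and> length p = n)"
      by (fastforce simp: length_Suc_conv intro: exI[of _ "(_, _) # _"])
    also have "\<dots> \<longleftrightarrow> (\<exists>w. (u, w) \<in> parcs G \<and> (w, v) \<in> parcs G ^^ n)"
      using Suc by blast
    also have "\<dots> \<longleftrightarrow> (u, v) \<in> parcs G ^^ Suc n"
      using relpow_Suc_I2 relpow_Suc_D2 by (metis (no_types))
    finally show ?case .
  qed auto
  then show ?thesis
    using assms by (simp add: pre_digraph.awalk_def pre_digraph.cas.simps cas_with_proj_eq)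
qed

lemma graph_dist_gadget_graph: "u \<in> boxes \<Longrightarrow> graph_dist gadget_graph (to_nat u) (to_nat v) = boxes.dist_E u v"
  unfolding graph_dist_def boxes.dist_E_def
  by (subst walk_iff_relpow) (simp_all add: pverts_gadget_graph relpow_gadget_graph)

lemma gromov_hyperbolic_gadget_graph: "gromov_hyperbolic gadget_graph"
proof (rule gromov_hyperbolicI)
  show "to_nat (([], 0, 0, 0, 0) :: vertex) \<in> pverts gadget_graph"
    using boxes.root_V by (simp add: pverts_gadget_graph)
  show "graph_dist gadget_graph x y = graph_dist gadget_graph y x"
    if "x \<in> pverts gadget_graph" "y \<in> pverts gadget_graph" for x y
    using that boxes.dist_E_commute by (auto simp: pverts_gadget_graph graph_dist_gadget_graph)
  fix x y z assume "x \<in> pverts gadget_graph" "y \<in> pverts gadget_graph" "z \<in> pverts gadget_graph"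
  then obtain u v w where "x = to_nat u" "y = to_nat v" "z = to_nat w" "u \<in> boxes" "v \<in> boxes" "w \<in> boxes"
    by (auto simp: pverts_gadget_graph)
  then show "min (gromov_product gadget_graph (to_nat (([], 0, 0, 0, 0) :: vertex)) x y)
      (gromov_product gadget_graph (to_nat (([], 0, 0, 0, 0) :: vertex)) y z) - 5 / 2
      \<le> gromov_product gadget_graph (to_nat (([], 0, 0, 0, 0) :: vertex)) x z"
    using boxes.dist_E_hyperbolic[of u v w]
    by (simp add: gromov_product_def graph_dist_gadget_graph boxes.dist_E_root)
qed simp

lemma Image_gadget_graph: "parcs gadget_graph `` {to_nat u} = to_nat ` (adj `` {u})"
  by (auto elim!: parcs_gadget_graphE)

lemma finite_Image_gadget_graph: "finite (parcs gadget_graph `` {x})"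
proof (cases "x \<in> range (to_nat :: vertex \<Rightarrow> nat)")
  case True
  then show ?thesis using finite_adj by (auto simp: Image_gadget_graph)
next
  case False
  then have "parcs gadget_graph `` {x} = {}" by (auto elim!: parcs_gadget_graphE)
  then show ?thesis by simp
qed

lemma bounded_degree_gadget_graph: "bounded_degree gadget_graph"
  unfolding bounded_degree_def
proof (intro exI ballI)
  fix x assume "x \<in> pverts gadget_graph"
  then obtain u :: vertex where x: "x = to_nat u" unfolding pverts_gadget_graph by blast
  have out: "out_arcs (with_proj gadget_graph) x = Pair x ` (to_nat ` (adj `` {u}))"
    unfolding x Image_gadget_graph[symmetric] by (auto simp: out_arcs_def)
  have "card (Pair x ` (to_nat ` (adj `` {u}))) \<le> card (adj `` {u})"
    using finite_adj by (simp add: image_image card_image_le)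
  then show "finite (out_arcs (with_proj gadget_graph) x) \<and> out_degree (with_proj gadget_graph) x \<le> 108"
    unfolding out_degree_def out using finite_adj card_adj_le[of u] by simp
qed

section \<open>Recurrence of the subtrees\<close>

lemma no_transient_subtree_gadget_graph:
  assumes "subtree T gadget_graph"
  shows "\<not> transient T"
proof (rule undirected_tree_not_transient)
  have sub: "pverts T \<subseteq> pverts gadget_graph" "parcs T \<subseteq> parcs gadget_graph"
    using assms by (auto simp: subtree_def subgraph_def)
  let ?dec = "from_nat :: nat \<Rightarrow> vertex"
  have arc: "\<exists>u v. x = to_nat u \<and> y = to_nat v \<and> (u, v) \<in> adj" if "(x, y) \<in> parcs T" for x y
    using that sub by (blast elim: parcs_gadget_graphE)
  show "undirected_tree T" using assms by (simp add: subtree_def)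
  show "finite (parcs T `` {x})" for x
    by (rule finite_subset[OF _ finite_Image_gadget_graph[of x]]) (use sub in auto)
  show "level (?dec y) \<le> Suc (level (?dec x))" if "(x, y) \<in> parcs T" for x y
    using arc[OF that] adj_level by auto
  show "y = to_nat ((\<tau>, 0, 0, 0, 0) :: vertex)"
    if xy: "(x, y) \<in> parcs T" "\<not> suffix \<tau> (fst (?dec x))" "suffix \<tau> (fst (?dec y))" for x y \<tau>
  proof -
    obtain u v where "x = to_nat u" "y = to_nat v" "(u, v) \<in> adj" using arc[OF xy(1)] by blast
    then show ?thesis using xy(2,3) adj_enter[of u v \<tau>] by simp
  qed
  show "x = to_nat ((\<tau>, 2 ^ length \<tau>, 0, 0, 0) :: vertex)"
    if xy: "(x, y) \<in> parcs T" "\<not> strict_suffix \<tau> (fst (?dec x))" "strict_suffix \<tau> (fst (?dec y))" for x y \<tau>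
  proof -
    obtain u v where "x = to_nat u" "y = to_nat v" "(u, v) \<in> adj" using arc[OF xy(1)] by blast
    then show ?thesis using xy(2,3) adj_leave[of u v \<tau>] by simp
  qed
  show "finite {x \<in> pverts T. length (fst (?dec x)) \<le> n}" for n
  proof (rule finite_subset)
    show "{x \<in> pverts T. length (fst (?dec x)) \<le> n} \<subseteq> to_nat ` {v \<in> boxes. length (fst v) \<le> n}"
      using sub(1) by (auto simp: pverts_gadget_graph)
  qed (intro finite_imageI finite_boxes)
  show "level (?dec (to_nat ((\<tau>, 0, 0, 0, 0) :: vertex))) = offset (length \<tau>)" for \<tau> by simp
  show "level (?dec (to_nat ((\<tau>, 2 ^ length \<tau>, 0, 0, 0) :: vertex))) = offset (length \<tau>) + 2 ^ length \<tau>" for \<tau> by simp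
  show "offset (Suc n) = offset n + 2 ^ n + 1" for n by simp
qed

section \<open>Transience of the graph\<close>

interpretation gadget: locally_finite_graph gadget_graph
proof
  show "(v, u) \<in> parcs gadget_graph" if "(u, v) \<in> parcs gadget_graph" for u v
    using that boxes.sym_E by (auto elim!: parcs_gadget_graphE dest: symD)
  show "finite (parcs gadget_graph `` {v})" for v by (rule finite_Image_gadget_graph)
qed

definition dirichlet_sum :: "(vertex \<Rightarrow> real) \<Rightarrow> (vertex \<times> vertex) set \<Rightarrow> real" where
  "dirichlet_sum h A = (\<Sum>a\<in>A. (h (fst a) - h (snd a))\<^sup>2)"

text \<open>Assigning an arc to the block of its tail keeps these sets disjoint for different
  addresses, so their Dirichlet sums add up to at most the energy.\<close>

definition arcs_from :: "bool list \<Rightarrow> (vertex \<times> vertex) set" where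
  "arcs_from \<sigma> = {a \<in> adj. fst (fst a) = \<sigma>}"

lemma finite_arcs_from: "finite (arcs_from \<sigma>)"
proof -
  let ?S = "{v \<in> boxes. length (fst v) \<le> length \<sigma>}"
  have "arcs_from \<sigma> \<subseteq> (SIGMA u:?S. adj `` {u})"
    by (auto simp: arcs_from_def boxes.E_def)
  then show ?thesis using finite_boxes finite_adj by (rule finite_subset[OF _ finite_SigmaI])
qed

lemma dirichlet_sum_le_energy:
  assumes "finite {x. f x \<noteq> 0}" "finite A" "A \<subseteq> adj"
  shows "dirichlet_sum (f \<circ> to_nat) A \<le> energy gadget_graph f"
proof -
  have "dirichlet_sum (f \<circ> to_nat) A = (\<Sum>a\<in>map_prod to_nat to_nat ` A. (f (fst a) - f (snd a))\<^sup>2)"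
    unfolding dirichlet_sum_def by (subst sum.reindex) (auto simp: inj_on_def)
  also have "\<dots> \<le> energy gadget_graph f"
    using assms by (intro gadget.sum_le_energy[OF assms(1)]) (auto simp: parcs_gadget_graph)
  finally show ?thesis .
qed

lemma sum_le_dirichlet_sum:
  assumes "inj_on \<iota> I" "\<iota> ` I \<subseteq> arcs_from \<sigma>"
  shows "(\<Sum>i\<in>I. (h (fst (\<iota> i)) - h (snd (\<iota> i)))\<^sup>2) \<le> dirichlet_sum h (arcs_from \<sigma>)"
proof -
  have "(\<Sum>i\<in>I. (h (fst (\<iota> i)) - h (snd (\<iota> i)))\<^sup>2) = dirichlet_sum h (\<iota> ` I)"
    unfolding dirichlet_sum_def by (subst sum.reindex[OF assms(1)]) simp
  also have "\<dots> \<le> dirichlet_sum h (arcs_from \<sigma>)"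
    unfolding dirichlet_sum_def using assms(2) by (intro sum_mono2 finite_arcs_from) auto
  finally show ?thesis .
qed

text \<open>\<open>box_average_bound\<close> with depth \<open>2 ^ length \<sigma>\<close>. In
  electrical terms, the resistance between entry and exit is bounded uniformly in the
  generation.\<close>

lemma across_gadget:
  "(h (\<sigma>, 0, 0, 0, 0) - h (\<sigma>, 2 ^ length \<sigma>, 0, 0, 0))\<^sup>2 \<le> 320 * dirichlet_sum h (arcs_from \<sigma>)"
proof (rule box_average_bound[of "2 ^ length \<sigma>" "\<lambda>k p q r. h (\<sigma>, k, p, q, r)"])
  let ?L = "2 ^ length \<sigma> :: nat"
  fix k assume k: "k < ?L"
  let ?I = "{..<2 ^ Suc k} \<times> {..<2 ^ Suc k} \<times> {..<2 ^ Suc k} :: (nat \<times> nat \<times> nat) set"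
  let ?\<iota> = "\<lambda>(p, q, r). ((\<sigma>, Suc k, p, q, r), parent (\<sigma>, Suc k, p, q, r))"
  have "inj_on ?\<iota> ?I" by (auto simp: inj_on_def)
  moreover have "?\<iota> ` ?I \<subseteq> arcs_from \<sigma>"
  proof (rule image_subsetI)
    fix i assume "i \<in> ?I"
    then obtain p q r where "i = (p, q, r)" "(\<sigma>, Suc k, p, q, r) \<in> boxes"
      using k by (cases i) (auto simp: boxes_def)
    then show "?\<iota> i \<in> arcs_from \<sigma>" by (auto simp: arcs_from_def intro!: adj_parentI)
  qed
  ultimately have "(\<Sum>i\<in>?I. (h (fst (?\<iota> i)) - h (snd (?\<iota> i)))\<^sup>2) \<le> dirichlet_sum h (arcs_from \<sigma>)"
    by (rule sum_le_dirichlet_sum)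
  then show "(\<Sum>p<2 ^ Suc k. \<Sum>q<2 ^ Suc k. \<Sum>r<2 ^ Suc k.
      (h (\<sigma>, Suc k, p, q, r) - h (\<sigma>, k, p div 2, q div 2, r div 2))\<^sup>2) \<le> dirichlet_sum h (arcs_from \<sigma>)"
    unfolding sum.cartesian_product by (simp add: case_prod_beta)
next
  let ?L = "2 ^ length \<sigma> :: nat"
  have hor: "(\<Sum>i\<in>I. (h (fst (\<iota> i)) - h (snd (\<iota> i)))\<^sup>2) \<le> dirichlet_sum h (arcs_from \<sigma>)"
    if "I \<subseteq> {..<2 ^ ?L} \<times> {..<2 ^ ?L} \<times> {..<2 ^ ?L}" "inj_on \<iota> I"
      "\<And>i. i \<in> I \<Longrightarrow> fst (\<iota> i) \<in> boxes \<and> snd (\<iota> i) = (\<sigma>, ?L, i) \<and> fst (fst (\<iota> i)) = \<sigma> \<and>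
        fst (\<iota> i) \<noteq> snd (\<iota> i) \<and> beside (fst (\<iota> i)) (snd (\<iota> i))"
    for I :: "(nat \<times> nat \<times> nat) set" and \<iota>
  proof (rule sum_le_dirichlet_sum[OF that(2)])
    show "\<iota> ` I \<subseteq> arcs_from \<sigma>"
    proof (rule image_subsetI)
      fix i assume i: "i \<in> I"
      then have "(\<sigma>, ?L, i) \<in> boxes" using that(1) by (cases i) (auto simp: boxes_def)
      then have "(fst (\<iota> i), snd (\<iota> i)) \<in> adj"
        using that(3)[OF i] by (metis adj_besideI)
      then have "\<iota> i \<in> adj" by (simp only: prod.collapse)
      then show "\<iota> i \<in> arcs_from \<sigma>" using that(3)[OF i] by (simp only: arcs_from_def mem_Collect_eq)
    qed
  qed
  show "(\<Sum>p<2 ^ ?L - 1. \<Sum>q<2 ^ ?L. \<Sum>r<2 ^ ?L.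
      (h (\<sigma>, ?L, Suc p, q, r) - h (\<sigma>, ?L, p, q, r))\<^sup>2) \<le> dirichlet_sum h (arcs_from \<sigma>)"
    using hor[of "{..<2 ^ ?L - 1} \<times> {..<2 ^ ?L} \<times> {..<2 ^ ?L}"
        "\<lambda>(p, q, r). ((\<sigma>, ?L, Suc p, q, r), (\<sigma>, ?L, p, q, r))"]
    unfolding sum.cartesian_product by (force simp: case_prod_beta inj_on_def boxes_def)
  show "(\<Sum>p<2 ^ ?L. \<Sum>q<2 ^ ?L - 1. \<Sum>r<2 ^ ?L.
      (h (\<sigma>, ?L, p, Suc q, r) - h (\<sigma>, ?L, p, q, r))\<^sup>2) \<le> dirichlet_sum h (arcs_from \<sigma>)"
    using hor[of "{..<2 ^ ?L} \<times> {..<2 ^ ?L - 1} \<times> {..<2 ^ ?L}"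
        "\<lambda>(p, q, r). ((\<sigma>, ?L, p, Suc q, r), (\<sigma>, ?L, p, q, r))"]
    unfolding sum.cartesian_product by (force simp: case_prod_beta inj_on_def boxes_def)
  show "(\<Sum>p<2 ^ ?L. \<Sum>q<2 ^ ?L. \<Sum>r<2 ^ ?L - 1.
      (h (\<sigma>, ?L, p, q, Suc r) - h (\<sigma>, ?L, p, q, r))\<^sup>2) \<le> dirichlet_sum h (arcs_from \<sigma>)"
    using hor[of "{..<2 ^ ?L} \<times> {..<2 ^ ?L} \<times> {..<2 ^ ?L - 1}"
        "\<lambda>(p, q, r). ((\<sigma>, ?L, p, q, Suc r), (\<sigma>, ?L, p, q, r))"]
    unfolding sum.cartesian_product by (force simp: case_prod_beta inj_on_def boxes_def)
qed

text \<open>From entry to exit of \<open>\<tau>\<close>, then along the edge to the next entry;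
  squaring a sum of two terms doubles the constants 320 and 1.\<close>

lemma down_step:
  "(h (\<tau>, 0, 0, 0, 0) - h (b # \<tau>, 0, 0, 0, 0))\<^sup>2
    \<le> 640 * dirichlet_sum h (arcs_from \<tau>) + 2 * dirichlet_sum h (arcs_from (b # \<tau>))"
proof -
  let ?a = "((b # \<tau>, 0, 0, 0, 0), (\<tau>, 2 ^ length \<tau>, 0, 0, 0)) :: vertex \<times> vertex"
  have "(b # \<tau>, 0, 0, 0, 0) \<in> boxes" by (simp add: boxes_def)
  then have "?a \<in> arcs_from (b # \<tau>)" by (auto simp: arcs_from_def intro!: adj_parentI)
  then have "(h (fst ?a) - h (snd ?a))\<^sup>2 \<le> dirichlet_sum h (arcs_from (b # \<tau>))"
    unfolding dirichlet_sum_def by (intro member_le_sum finite_arcs_from) auto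
  moreover have "(x - z)\<^sup>2 \<le> 2 * ((x - y)\<^sup>2 + (z - y)\<^sup>2)" for x y z :: real
    using zero_le_power2[of "2 * y - x - z"] by (simp add: power2_eq_square algebra_simps)
  note this[of "h (\<tau>, 0, 0, 0, 0)" "h (b # \<tau>, 0, 0, 0, 0)" "h (\<tau>, 2 ^ length \<tau>, 0, 0, 0)"]
  ultimately show ?thesis using across_gadget[of h \<tau>] by simp
qed

text \<open>The average \<open>m n\<close> of the values at the entries of generation
  \<open>n\<close> is compared with the next one. As \<open>2 ^ Suc n\<close> branches act in
  parallel, the squared increments decay like \<open>(1 / 2) ^ n\<close>, and \<open>m n = 0\<close>
  beyond the support. The constant is \<open>16 * 641\<close>.\<close>

lemma root_bound:
  assumes "finite {x. f x \<noteq> 0}"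
  shows "(f (to_nat (([], 0, 0, 0, 0) :: vertex)))\<^sup>2 \<le> 10256 * energy gadget_graph f"
proof -
  define h where "h = f \<circ> (to_nat :: vertex \<Rightarrow> nat)"
  define a where "a \<sigma> = h (\<sigma>, 0, 0, 0, 0)" for \<sigma>
  define \<Lambda> where "\<Lambda> n = {\<sigma> :: bool list. length \<sigma> = n}" for n
  have \<Lambda>: "finite (\<Lambda> n)" "card (\<Lambda> n) = 2 ^ n" for n
    using finite_lists_length_eq[of "UNIV :: bool set" n] card_lists_length_eq[of "UNIV :: bool set" n]
    by (simp_all add: \<Lambda>_def)
  have \<Lambda>_Suc: "(\<Sum>\<sigma>\<in>\<Lambda> (Suc n). g \<sigma>) = (\<Sum>\<tau>\<in>\<Lambda> n. g (True # \<tau>) + g (False # \<tau>))" for n and g :: "bool list \<Rightarrow> real"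
  proof -
    have "\<Lambda> (Suc n) = (\<lambda>\<tau>. True # \<tau>) ` \<Lambda> n \<union> (\<lambda>\<tau>. False # \<tau>) ` \<Lambda> n"
      by (auto simp: \<Lambda>_def length_Suc_conv image_iff)
    then have "(\<Sum>\<sigma>\<in>\<Lambda> (Suc n). g \<sigma>) = (\<Sum>\<sigma>\<in>(\<lambda>\<tau>. True # \<tau>) ` \<Lambda> n. g \<sigma>) + (\<Sum>\<sigma>\<in>(\<lambda>\<tau>. False # \<tau>) ` \<Lambda> n. g \<sigma>)"
      using \<Lambda> by (simp only:) (intro sum.union_disjoint, auto)
    then show ?thesis by (simp add: sum.reindex inj_on_def sum.distrib)
  qed
  have sum_over_blocks: "(\<Sum>\<sigma>\<in>\<Lambda> n. dirichlet_sum h (arcs_from \<sigma>)) \<le> energy gadget_graph f" for n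
  proof -
    have "(\<Sum>\<sigma>\<in>\<Lambda> n. dirichlet_sum h (arcs_from \<sigma>)) = dirichlet_sum h (\<Union>\<sigma>\<in>\<Lambda> n. arcs_from \<sigma>)"
      unfolding dirichlet_sum_def using \<Lambda> finite_arcs_from
      by (subst sum.UNION_disjoint) (auto simp: arcs_from_def)
    also have "\<dots> \<le> energy gadget_graph f"
      unfolding h_def using \<Lambda> finite_arcs_from
      by (intro dirichlet_sum_le_energy assms) (auto simp: arcs_from_def)
    finally show ?thesis .
  qed
  define m where "m n = (\<Sum>\<sigma>\<in>\<Lambda> n. a \<sigma>) / 2 ^ n" for n
  have energy: "0 \<le> energy gadget_graph f" by (simp add: energy_def sum_nonneg)
  have step: "(m (Suc n) - m n)\<^sup>2 \<le> 641 * energy gadget_graph f * (1 / 2) ^ n" for n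
  proof -
    define d where "d \<sigma> = a \<sigma> - a (tl \<sigma>)" for \<sigma>
    have "m (Suc n) - m n = (\<Sum>\<sigma>\<in>\<Lambda> (Suc n). d \<sigma>) / 2 ^ Suc n"
      unfolding m_def d_def \<Lambda>_Suc
      by (simp add: sum_subtractf sum.distrib field_simps flip: sum_distrib_right)
    then have "(m (Suc n) - m n)\<^sup>2 = (\<Sum>\<sigma>\<in>\<Lambda> (Suc n). d \<sigma>)\<^sup>2 / (2 ^ Suc n)\<^sup>2"
      by (simp add: power_divide)
    also have "\<dots> \<le> ((\<Sum>\<sigma>\<in>\<Lambda> (Suc n). (d \<sigma>)\<^sup>2) * card (\<Lambda> (Suc n))) / (2 ^ Suc n)\<^sup>2"
      by (intro divide_right_mono sum_squared_le_sum_of_squares) auto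
    also have "\<dots> = (\<Sum>\<sigma>\<in>\<Lambda> (Suc n). (d \<sigma>)\<^sup>2) / 2 ^ Suc n"
      unfolding \<Lambda> by (simp add: power2_eq_square)
    \<comment> \<open>\<open>1282 = 2 * 640 + 2\<close>, since each block serves both of its
      children; dividing by \<open>2 ^ Suc n\<close> leaves 641.\<close>
    also have "(\<Sum>\<sigma>\<in>\<Lambda> (Suc n). (d \<sigma>)\<^sup>2) \<le> 1282 * energy gadget_graph f"
    proof -
      have d: "(d (b # \<tau>))\<^sup>2 \<le> 640 * dirichlet_sum h (arcs_from \<tau>) + 2 * dirichlet_sum h (arcs_from (b # \<tau>))" for b \<tau>
        using down_step[of h \<tau> b] by (simp add: d_def a_def power2_commute)
      have "(\<Sum>\<sigma>\<in>\<Lambda> (Suc n). (d \<sigma>)\<^sup>2)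
          \<le> (\<Sum>\<tau>\<in>\<Lambda> n. 1280 * dirichlet_sum h (arcs_from \<tau>) + 2 * (dirichlet_sum h (arcs_from (True # \<tau>)) + dirichlet_sum h (arcs_from (False # \<tau>))))"
        unfolding \<Lambda>_Suc
      proof (rule sum_mono)
        fix \<tau>
        show "(d (True # \<tau>))\<^sup>2 + (d (False # \<tau>))\<^sup>2
          \<le> 1280 * dirichlet_sum h (arcs_from \<tau>) + 2 * (dirichlet_sum h (arcs_from (True # \<tau>)) + dirichlet_sum h (arcs_from (False # \<tau>)))"
          using d[of True \<tau>] d[of False \<tau>] by simp
      qed
      also have "\<dots> = 1280 * (\<Sum>\<tau>\<in>\<Lambda> n. dirichlet_sum h (arcs_from \<tau>)) + 2 * (\<Sum>\<sigma>\<in>\<Lambda> (Suc n). dirichlet_sum h (arcs_from \<sigma>))"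
        unfolding \<Lambda>_Suc by (simp add: sum.distrib flip: sum_distrib_left)
      also have "\<dots> \<le> 1280 * energy gadget_graph f + 2 * energy gadget_graph f"
        by (intro add_mono mult_left_mono sum_over_blocks) auto
      finally show ?thesis by simp
    qed
    finally show ?thesis by (simp add: divide_right_mono power_one_over field_simps)
  qed
  \<comment> \<open>A generation beyond all those met by the finite support.\<close>
  have "finite (\<Union>x\<in>{x. f x \<noteq> 0}. {length (fst (from_nat x :: vertex))})"
    using assms by auto
  then obtain n where n: "\<And>x. f x \<noteq> 0 \<Longrightarrow> length (fst (from_nat x :: vertex)) < n"
    unfolding finite_nat_iff_bounded by auto
  have "a \<sigma> = 0" if "\<sigma> \<in> \<Lambda> n" for \<sigma>
    using n[of "to_nat ((\<sigma>, 0, 0, 0, 0) :: vertex)"] that by (auto simp: a_def h_def \<Lambda>_def)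
  then have "m n = 0" by (simp add: m_def)
  moreover have "m 0 = f (to_nat (([], 0, 0, 0, 0) :: vertex))"
    by (simp add: m_def \<Lambda>_def a_def h_def)
  moreover have "(m n - m 0)\<^sup>2 \<le> 16 * (641 * energy gadget_graph f)"
    by (rule geometric_telescope) (use energy step in auto)
  ultimately show ?thesis by simp
qed

lemma transient_gadget_graph: "transient gadget_graph"
  unfolding transient_def
proof
  fix x assume "x \<in> pverts gadget_graph"
  then obtain u where u: "u \<in> boxes" "x = to_nat u" by (auto simp: pverts_gadget_graph)
  have "(to_nat (([], 0, 0, 0, 0) :: vertex), x) \<in> parcs gadget_graph ^^ boxes.dist_E ([], 0, 0, 0, 0) u"
    using boxes.dist_E_walk[OF boxes.root_V u(1)] relpow_gadget_graph u(2) by simp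
  then have "(to_nat (([], 0, 0, 0, 0) :: vertex), x) \<in> (parcs gadget_graph)\<^sup>*"
    by (rule relpow_imp_rtrancl)
  \<comment> \<open>The bound at the root is carried along a walk to \<open>x\<close>; each edge
    turns the constant \<open>C\<close> into \<open>2 * C + 2\<close>.\<close>
  then have "\<exists>C. \<forall>f. finite {v. f v \<noteq> 0} \<longrightarrow> (f x)\<^sup>2 \<le> C * energy gadget_graph f"
  proof (induction rule: rtrancl_induct)
    case base
    show ?case using root_bound by blast
  next
    case (step y z)
    then obtain C where C: "\<And>f. finite {v. f v \<noteq> 0} \<Longrightarrow> (f y)\<^sup>2 \<le> C * energy gadget_graph f" by blast
    have "(f z)\<^sup>2 \<le> (2 * C + 2) * energy gadget_graph f" if "finite {v. f v \<noteq> 0}" for f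
    proof -
      have "(f y - f z)\<^sup>2 \<le> energy gadget_graph f"
        using gadget.sum_le_energy[OF that, where A = "{(y, z)}"] step(2) by simp
      moreover have "s\<^sup>2 \<le> 2 * (r\<^sup>2 + (r - s)\<^sup>2)" for r s :: real
        using zero_le_power2[of "2 * r - s"] by (simp add: power2_eq_square algebra_simps)
      note this[of "f z" "f y"]
      ultimately show ?thesis using C[OF that] by (simp add: algebra_simps)
    qed
    then show ?case by blast
  qed
  then obtain C where "\<And>f. finite {v. f v \<noteq> 0} \<Longrightarrow> (f x)\<^sup>2 \<le> C * energy gadget_graph f" by blast
  then show "measure (srw gadget_graph x) {\<omega>. \<exists>n\<ge>1. \<omega> n = x} < 1"
    by (rule gadget.return_prob_less_1)
qed

theorem theorem6p1:
  shows "\<exists>G :: nat pair_pre_digraph.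
           pair_bidirected_digraph G \<and>
           Digraph_Component.connected (with_proj G) \<and>
           bounded_degree G \<and>
           transient G \<and>
           gromov_hyperbolic G \<and>
           \<not> (\<exists>T. subtree T G \<and> transient T)"
  using pair_bidirected_gadget_graph connected_gadget_graph bounded_degree_gadget_graph
    transient_gadget_graph gromov_hyperbolic_gadget_graph no_transient_subtree_gadget_graph
  by blast

end
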